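(* Assume that $\ell(\cdot,b):\mathbb{R}^s\to\mathbb{R}$ is $L_\ell$-smooth and convex and that each $r_i:\mathbb{R}^{d_i}\to\mathbb{R}$ ($i=1,\dots,n$) is $L_r$-smooth and convex. Let $\mathbb{E}[\xi^k]=0$, $\mathbb{E}[\xi_i^k]=0$, $\mathbb{E}\|\xi^k\|^2\le\sigma^2$ and $\mathbb{E}\|\xi_i^k\|^2\le\sigma^2$, and the same for $\xi^{k+1/2}$ and $\xi_i^{k+1/2}$. Let the saddle point problem described in the context be solved by the algorithm with additive noise described there. Then for $$\gamma=\min\left\{\frac12;\ \frac1{\sqrt{8\lambda_{\max}(A^TA)}};\ \frac1{2L_r};\ \frac1{2L_\ell};\ \sqrt{\frac{D^2}{8(\lambda_{\max}(AA^T)+n)\sigma^2K}}\right\}$$ it holds that $$\mathbb{E}\left[\mathrm{gap}(\bar x^K,\bar z^K,\bar y^K)\right]=\mathcal{O}\left(\frac{\left(1+\sqrt{\lambda_{\max}(A^TA)}+L_r+L_\ell\right)D^2}{K}+\sqrt{\frac{(\lambda_{\max}(AA^T)+n)\sigma^2D^2}{K}}\right),$$ where $\bar x^K=\frac1K\sum_{k=0}^{K-1}x^{k+1/2}$, $\bar z^K=\frac1K\sum_{k=0}^{K-1}z^{k+1/2}$, $\bar y^K=\frac1K\sum_{k=0}^{K-1}y^{k+1/2}$ and $D^2=\max_{x\in\mathcal X,z\in\mathcal Z,y\in\mathcal Y}\left[\|x^0-x\|^2+\|z^0-z\|^2+\|y^0-y\|^2\right]$.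
   Context: Setting: $n,s,d_1,\dots,d_n$ are positive integers, $d=\sum_i d_i$, $A_i\in\mathbb{R}^{s\times d_i}$, $A=[A_1,\dots,A_n]\in\mathbb{R}^{s\times d}$, $b\in\mathbb{R}^s$ is fixed, and $x=(x_1,\dots,x_n)\in\mathbb{R}^d$ with $x_i\in\mathbb{R}^{d_i}$, so $Ax=\sum_iA_ix_i$. $\ell:\mathbb{R}^s\times\mathbb{R}^s\to\mathbb{R}$, and $\nabla\ell(z,b)$ is the gradient in the first argument. The saddle point problem is $\min_{(x,z)\in\mathbb{R}^{d+s}}\max_{y\in\mathbb{R}^s}L(x,z,y)$ with $$L(x,z,y)=\ell(z,b)+\sum_{i=1}^n r_i(x_i)+y^T\Big(\sum_{i=1}^nA_ix_i-z\Big).$$ $\mathcal X\subset\mathbb{R}^d$, $\mathcal Z\subset\mathbb{R}^s$, $\mathcal Y\subset\mathbb{R}^s$ are compact sets used only to define the convergence criterion $$\mathrm{gap}(x,z,y)=\max_{\tilde y\in\mathcal Y}L(x,z,\tilde y)-\min_{\tilde x\in\mathcal X,\tilde z\in\mathcal Z}L(\tilde x,\tilde z,y).$$ A function $f$ is $L$-smooth ($L>0$) if $\|\nabla f(u)-\nabla f(v)\|\le L\|u-v\|$ for all $u,v$. Norms are Euclidean; $\lambda_{\max}$ is the largest eigenvalue. Algorithm ($n$ devices; device $i$ holds $A_i$ and $x_i$; the first device also holds $z$, $y$ and $b$): inputs are a starting point $(x^0,z^0,y^0)\in\mathbb{R}^{d+2s}$, a stepsize $\gamma>0$ and the number of steps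 $K$. For $k=0,\dots,K-1$: the first device generates noise $\xi^k\in\mathbb{R}^s$ and sends $y^k+\xi^k$ to the other devices; each device $i$ generates noise $\xi_i^k\in\mathbb{R}^s$ and sends $A_ix_i^k+\xi_i^k$ to the first device; $x_i^{k+1/2}=x_i^k-\gamma(A_i^T(y^k+\xi^k)+\nabla r_i(x_i^k))$ for all $i$; $z^{k+1/2}=z^k-\gamma(\nabla\ell(z^k,b)-y^k)$; $y^{k+1/2}=y^k+\gamma(\sum_i(A_ix_i^k+\xi_i^k)-z^k)$; the first device generates noise $\xi^{k+1/2}\in\mathbb{R}^s$ and sends $y^{k+1/2}+\xi^{k+1/2}$ to the other devices; each device $i$ generates noise $\xi_i^{k+1/2}\in\mathbb{R}^s$ and sends $A_ix_i^{k+1/2}+\xi_i^{k+1/2}$ to the first device; $x_i^{k+1}=x_i^k-\gamma(A_i^T(y^{k+1/2}+\xi^{k+1/2})+\nabla r_i(x_i^{k+1/2}))$ for all $i$; $z^{k+1}=z^k-\gamma(\nabla\ell(z^{k+1/2},b)-y^{k+1/2})$; $y^{k+1}=y^k+\gamma(\sum_i(A_ix_i^{k+1/2}+\xi_i^{k+1/2})-z^{k+1/2})$.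
   Formalization: All noises (every device, every whole and half step) are assumed mutually independent; with only zero mean and bounded second moments the claim fails, e.g. when one random noise is reused at every step. *)

theory Defs
  imports "HOL-Probability.Probability"
begin

text \<open>
  The blocks \<open>x = (x\<^sub>1, \<dots>, x\<^sub>n)\<close> with \<open>x\<^sub>i\<close> in \<open>\<real>\<close> to the power \<open>d\<^sub>i\<close> are encoded by a map
  \<open>blk :: 'd \<Rightarrow> 'n\<close> that sends each of the \<open>d\<close> coordinates to the block containing it, so that
  \<open>n = CARD('n)\<close>, \<open>d = CARD('d)\<close>, \<open>d\<^sub>i\<close> is the number of coordinates sent to \<open>i\<close>, and surjectivity of
  \<open>blk\<close> says that every \<open>d\<^sub>i\<close> is positive. The space of \<open>x\<^sub>i\<close> is identified with the coordinate
  subspace \<open>block_space blk i\<close>, and \<open>A\<^sub>i\<close> with the matrix obtained from \<open>A\<close> by zeroing the columns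
  outside block \<open>i\<close>; its transpose maps into \<open>block_space blk i\<close>.
\<close>

definition block_space :: "('d::finite \<Rightarrow> 'n) \<Rightarrow> 'n \<Rightarrow> (real^'d) set" where
  "block_space blk i = {v. \<forall>j. blk j \<noteq> i \<longrightarrow> v $ j = 0}"

definition block :: "('d::finite \<Rightarrow> 'n) \<Rightarrow> 'n \<Rightarrow> real^'d \<Rightarrow> real^'d" where
  "block blk i x = (\<chi> j. if blk j = i then x $ j else 0)"

definition block_matrix :: "('d::finite \<Rightarrow> 'n) \<Rightarrow> real^'d^'s \<Rightarrow> 'n \<Rightarrow> real^'d^'s" where
  "block_matrix blk A i = (\<chi> p q. if blk q = i then A $ p $ q else 0)"

text \<open>
  Gradient of a function defined on a linear subspace \<open>S\<close>, as a vector of \<open>S\<close>; on a subspace it is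
  unique where it exists. Values of the function outside \<open>S\<close> are irrelevant.
\<close>

definition gradient_on :: "'a::euclidean_space set \<Rightarrow> ('a \<Rightarrow> real) \<Rightarrow> 'a \<Rightarrow> 'a" where
  "gradient_on S f u = (THE g. g \<in> S \<and> (f has_derivative (\<lambda>h. g \<bullet> h)) (at u within S))"

definition L_smooth_on :: "'a::euclidean_space set \<Rightarrow> real \<Rightarrow> ('a \<Rightarrow> real) \<Rightarrow> bool" where
  "L_smooth_on S L f \<longleftrightarrow> 0 < L \<and> f differentiable_on S \<and>
     (\<forall>u\<in>S. \<forall>v\<in>S. norm (gradient_on S f u - gradient_on S f v) \<le> L * norm (u - v))"

definition lambda_max :: "real^'m^'m \<Rightarrow> real" where
  "lambda_max M = Max {c. \<exists>v. v \<noteq> 0 \<and> M *v v = c *\<^sub>R v}"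

type_synonym ('d, 's) point = "(real^'d) \<times> (real^'s) \<times> (real^'s)"

definition lagrangian ::
  "('d::finite \<Rightarrow> 'n::finite) \<Rightarrow> real^'d^'s \<Rightarrow> real^'s \<Rightarrow> (real^'s \<Rightarrow> real^'s \<Rightarrow> real) \<Rightarrow>
   ('n \<Rightarrow> real^'d \<Rightarrow> real) \<Rightarrow> real^'d \<Rightarrow> real^'s \<Rightarrow> real^'s \<Rightarrow> real" where
  "lagrangian blk A b ell r x z y =
     ell z b + (\<Sum>i\<in>UNIV. r i (block blk i x)) +
     y \<bullet> ((\<Sum>i\<in>UNIV. block_matrix blk A i *v block blk i x) - z)"

text \<open>The sets are used when compact and nonempty, so supremum and infimum are attained.\<close>

definition gap ::
  "('d::finite \<Rightarrow> 'n::finite) \<Rightarrow> real^'d^'s \<Rightarrow> real^'s \<Rightarrow> (real^'s \<Rightarrow> real^'s \<Rightarrow> real) \<Rightarrow>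
   ('n \<Rightarrow> real^'d \<Rightarrow> real) \<Rightarrow> (real^'d) set \<Rightarrow> (real^'s) set \<Rightarrow> (real^'s) set \<Rightarrow>
   ('d, 's) point \<Rightarrow> real" where
  "gap blk A b ell r X Z Y = (\<lambda>(x, z, y).
     (SUP y'\<in>Y. lagrangian blk A b ell r x z y') -
     (INF (x', z')\<in>X \<times> Z. lagrangian blk A b ell r x' z' y))"

definition diam_sq ::
  "(real^'d) set \<Rightarrow> (real^'s) set \<Rightarrow> (real^'s) set \<Rightarrow> ('d, 's) point \<Rightarrow> real" where
  "diam_sq X Z Y = (\<lambda>(x0, z0, y0).
     (SUP (x, z, y)\<in>X \<times> Z \<times> Y. (norm (x0 - x))\<^sup>2 + (norm (z0 - z))\<^sup>2 + (norm (y0 - y))\<^sup>2))"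

text \<open>
  Noise is indexed by iteration \<open>k\<close>, by whether it belongs to time \<open>k\<close> (\<open>Full\<close>) or \<open>k + 1/2\<close>
  (\<open>Half\<close>), and by its role: \<open>Dual\<close> is added to the transmitted \<open>y\<close> (the noise without device
  index), \<open>Device i\<close> to the transmitted \<open>A\<^sub>i x\<^sub>i\<close>.
\<close>

datatype stage = Full | Half

datatype 'n noise_role = Dual | Device 'n

text \<open>
  Both updates of an iteration move from the base point \<open>(x, z, y)\<close>; they differ in the point
  \<open>(u, v, w)\<close> and the noise \<open>e\<close> at which the operator is evaluated.
\<close>

definition update ::
  "('d::finite \<Rightarrow> 'n::finite) \<Rightarrow> real^'d^'s \<Rightarrow> real^'s \<Rightarrow> (real^'s \<Rightarrow> real^'s \<Rightarrow> real) \<Rightarrow>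
   ('n \<Rightarrow> real^'d \<Rightarrow> real) \<Rightarrow> real \<Rightarrow>
   ('d, 's) point \<Rightarrow> ('d, 's) point \<Rightarrow> ('n noise_role \<Rightarrow> real^'s) \<Rightarrow>
   ('d, 's) point" where
  "update blk A b ell r \<gamma> = (\<lambda>(x, z, y) (u, v, w) e.
     ((\<Sum>i\<in>UNIV. block blk i x -
         \<gamma> *\<^sub>R (transpose (block_matrix blk A i) *v (w + e Dual) +
               gradient_on (block_space blk i) (r i) (block blk i u))),
      z - \<gamma> *\<^sub>R (gradient_on UNIV (\<lambda>t. ell t b) v - w),
      y + \<gamma> *\<^sub>R ((\<Sum>i\<in>UNIV. block_matrix blk A i *v block blk i u + e (Device i)) - v)))"

primrec iterate ::
  "('d::finite \<Rightarrow> 'n::finite) \<Rightarrow> real^'d^'s \<Rightarrow> real^'s \<Rightarrow> (real^'s \<Rightarrow> real^'s \<Rightarrow> real) \<Rightarrow>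
   ('n \<Rightarrow> real^'d \<Rightarrow> real) \<Rightarrow> real \<Rightarrow> ('d, 's) point \<Rightarrow>
   (nat \<Rightarrow> stage \<Rightarrow> 'n noise_role \<Rightarrow> real^'s) \<Rightarrow> nat \<Rightarrow> ('d, 's) point" where
  "iterate blk A b ell r \<gamma> p0 e 0 = p0"
| "iterate blk A b ell r \<gamma> p0 e (Suc k) =
     (let p = iterate blk A b ell r \<gamma> p0 e k;
          q = update blk A b ell r \<gamma> p p (e k Full)
      in update blk A b ell r \<gamma> p q (e k Half))"

definition half_iterate ::
  "('d::finite \<Rightarrow> 'n::finite) \<Rightarrow> real^'d^'s \<Rightarrow> real^'s \<Rightarrow> (real^'s \<Rightarrow> real^'s \<Rightarrow> real) \<Rightarrow>
   ('n \<Rightarrow> real^'d \<Rightarrow> real) \<Rightarrow> real \<Rightarrow> ('d, 's) point \<Rightarrow>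
   (nat \<Rightarrow> stage \<Rightarrow> 'n noise_role \<Rightarrow> real^'s) \<Rightarrow> nat \<Rightarrow> ('d, 's) point" where
  "half_iterate blk A b ell r \<gamma> p0 e k =
     (let p = iterate blk A b ell r \<gamma> p0 e k in update blk A b ell r \<gamma> p p (e k Full))"

definition average_iterate ::
  "('d::finite \<Rightarrow> 'n::finite) \<Rightarrow> real^'d^'s \<Rightarrow> real^'s \<Rightarrow> (real^'s \<Rightarrow> real^'s \<Rightarrow> real) \<Rightarrow>
   ('n \<Rightarrow> real^'d \<Rightarrow> real) \<Rightarrow> real \<Rightarrow> ('d, 's) point \<Rightarrow>
   (nat \<Rightarrow> stage \<Rightarrow> 'n noise_role \<Rightarrow> real^'s) \<Rightarrow> nat \<Rightarrow> ('d, 's) point" where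
  "average_iterate blk A b ell r \<gamma> p0 e K =
     (1 / real K) *\<^sub>R (\<Sum>k<K. half_iterate blk A b ell r \<gamma> p0 e k)"

text \<open>
  A term of the minimum whose denominator vanishes stands for infinity and is dropped, whereas
  \<open>1 / 0 = 0\<close> in HOL; hence the two case distinctions.
\<close>

definition stepsize ::
  "real^'d^'s \<Rightarrow> nat \<Rightarrow> real \<Rightarrow> real \<Rightarrow> real \<Rightarrow> real \<Rightarrow> nat \<Rightarrow> real" where
  "stepsize A n Lr Ll \<sigma> D2 K =
     Min ({1 / 2, 1 / (2 * Lr), 1 / (2 * Ll)} \<union>
          (if lambda_max (transpose A ** A) = 0 then {}
           else {1 / sqrt (8 * lambda_max (transpose A ** A))}) \<union>
          (if \<sigma> = 0 then {}
           else {sqrt (D2 / (8 * (lambda_max (A ** transpose A) + real n) * \<sigma>\<^sup>2 * real K))}))"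

text \<open>
  The constant hidden in an O-bound that is uniform in all parameters, dimensions included. The
  dimensions are cardinalities of type variables, so a constant bound by an existential quantifier
  inside the theorem could depend on them; a numeral cannot.
\<close>

definition rate_const :: real where
  "rate_const = 10"

end

theory Submission
  imports Defs
begin

text \<open>
  The algorithm is an extragradient method \<open>q = p - \<gamma> (F p + n)\<close>, \<open>p' = p - \<gamma> (F q + m)\<close> for the
  monotone operator \<open>F (x, z, y) = (A\<^sup>T y + \<nabla>r x, \<nabla>\<ell> z - y, z - A x)\<close>, with noise
  \<open>(A\<^sup>T \<xi>, 0, - \<Sum>\<^sub>i \<xi>\<^sub>i)\<close> of second moment at most \<open>v = (\<lambda>\<^sub>m\<^sub>a\<^sub>x (A A\<^sup>T) + n) \<sigma>\<^sup>2\<close>.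

  The stepsize makes \<open>\<gamma> F\<close> Lipschitz with the constant \<open>sqrt (7 / 8) < 1\<close>. This slack absorbs the
  correlation of \<open>F q\<close> with \<open>n\<close>, so that pathwise
  \<open>2 \<gamma> \<langle>F q + m, q - u\<rangle> \<le> \<parallel>p - u\<parallel>\<^sup>2 - \<parallel>p' - u\<parallel>\<^sup>2 + 8 \<gamma>\<^sup>2 \<parallel>m - n\<parallel>\<^sup>2\<close>. After summation over the
  iterations, the term \<open>\<langle>m, q - u\<rangle>\<close> is split as \<open>\<langle>m, q - p\<^sub>0\<rangle> + \<langle>m, p\<^sub>0 - u\<rangle>\<close>. The first part has
  expectation zero, since \<open>m\<close> is independent of the past. The sum of the second parts, where \<open>u\<close> may
  depend on the noise through the maximum in the gap, is at most
  \<open>\<parallel>p\<^sub>0 - u\<parallel>\<^sup>2 / (4 \<gamma>) + \<gamma> \<parallel>\<Sum> m\<parallel>\<^sup>2\<close>. Convexity turns the sum of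
  \<open>\<langle>F q, q - u\<rangle>\<close> into \<open>K\<close> times the gap, whose expectation is therefore at most
  \<open>3 D\<^sup>2 / (4 \<gamma> K) + 17 \<gamma> v\<close>.
\<close>

section \<open>Eigenvalues and gradients\<close>

lemma inner_transpose_matrix_vector:
  fixes B :: "real^'m^'k"
  shows "(transpose B *v u) \<bullet> v = u \<bullet> (B *v v)"
  by (simp add: dot_lmul_matrix[symmetric])

text \<open>Let \<open>v\<close> maximise the Rayleigh quotient on the unit sphere. The form
  \<open>q\<close> is nonnegative and vanishes at \<open>v\<close>, while along the residual
  \<open>g\<close> its first-order term is \<open>2 t (g \<bullet> g)\<close>; hence
  \<open>g = 0\<close> and \<open>v\<close> is an eigenvector.\<close>

lemma self_adjoint_top_eigenvector:
  fixes f :: "'a::euclidean_space \<Rightarrow> 'a"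
  assumes f: "linear f" and sa: "\<And>u v. f u \<bullet> v = u \<bullet> f v"
  shows "\<exists>c v. v \<noteq> 0 \<and> f v = c *\<^sub>R v \<and> (\<forall>w. w \<bullet> f w \<le> c * (norm w)\<^sup>2)"
proof -
  interpret linear f by fact
  have cont: "continuous_on (sphere 0 1) (\<lambda>v. v \<bullet> f v)"
    by (intro continuous_intros linear_continuous_on linear_conv_bounded_linear[THEN iffD1] f)
  have "sphere (0::'a) 1 \<noteq> {}" by simp
  from continuous_attains_sup[OF compact_sphere this cont]
  obtain v where v: "norm v = 1" and max: "\<And>w. norm w = 1 \<Longrightarrow> w \<bullet> f w \<le> v \<bullet> f v"
    by (auto simp: sphere_def)
  define c where "c = v \<bullet> f v"
  define q where "q = (\<lambda>w. c * (norm w)\<^sup>2 - w \<bullet> f w)"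
  have q0: "0 \<le> q w" for w
  proof (cases "w = 0")
    case False
    have "(w /\<^sub>R norm w) \<bullet> f (w /\<^sub>R norm w) \<le> c"
      unfolding c_def by (rule max) (use False in simp)
    then have "w \<bullet> f w / (norm w)\<^sup>2 \<le> c"
      by (simp add: scale power2_eq_square divide_inverse algebra_simps)
    with False show ?thesis by (simp add: q_def field_simps)
  qed (simp add: q_def)
  define g where "g = c *\<^sub>R v - f v"
  have expand: "q (v + t *\<^sub>R g) = 2 * t * (g \<bullet> g) + t\<^sup>2 * q g" for t
  proof -
    have "v \<bullet> v = 1" using v by (simp add: dot_square_norm)
    then have "c * (norm (v + t *\<^sub>R g))\<^sup>2 = c + 2 * t * c * (v \<bullet> g) + t\<^sup>2 * (c * (norm g)\<^sup>2)"
      by (simp only: power2_norm_eq_inner)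
        (simp add: inner_add inner_commute power2_eq_square algebra_simps)
    moreover have "(v + t *\<^sub>R g) \<bullet> f (v + t *\<^sub>R g) = c + 2 * t * (f v \<bullet> g) + t\<^sup>2 * (g \<bullet> f g)"
    proof -
      have "g \<bullet> f v = f v \<bullet> g" by (rule inner_commute)
      moreover have "v \<bullet> f g = f v \<bullet> g" by (rule sa[symmetric])
      ultimately show ?thesis
        by (simp add: add scale inner_add_left inner_add_right c_def power2_eq_square algebra_simps)
    qed
    moreover have "g \<bullet> g = c * (v \<bullet> g) - f v \<bullet> g"
      by (subst (1) g_def) (simp add: inner_diff_left)
    ultimately show ?thesis
      unfolding q_def by (simp only:) (simp add: algebra_simps)
  qed
  have "g \<bullet> g = 0"
  proof (rule ccontr)
    assume "g \<bullet> g \<noteq> 0"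
    then have pos: "g \<bullet> g > 0" by (simp add: inner_gt_zero_iff)
    \<comment> \<open>Negative and so small that the quadratic term offsets at most half of the
      linear one. The \<open>+ 1\<close> keeps the denominator positive when
      \<open>q g = 0\<close>.\<close>
    define t where "t = - (g \<bullet> g) / (q g + 1)"
    have "q g + 1 > 0" using q0[of g] by simp
    then have "t < 0" using pos by (simp add: t_def divide_neg_pos)
    have "0 \<le> t * (2 * (g \<bullet> g) + t * q g)"
      using q0[of "v + t *\<^sub>R g"] unfolding expand by (simp add: power2_eq_square algebra_simps)
    then have "2 * (g \<bullet> g) + t * q g \<le> 0"
      using \<open>t < 0\<close> by (simp add: zero_le_mult_iff)
    moreover have "t * q g \<ge> - (g \<bullet> g)"
    proof -
      have "(g \<bullet> g) * q g / (q g + 1) \<le> g \<bullet> g"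
        using pos q0[of g] by (simp add: divide_le_eq)
      then show ?thesis by (simp add: t_def)
    qed
    ultimately show False using pos by linarith
  qed
  then have "f v = c *\<^sub>R v" by (simp add: g_def)
  moreover have "v \<noteq> 0" using v by auto
  moreover have "w \<bullet> f w \<le> c * (norm w)\<^sup>2" for w using q0[of w] by (simp add: q_def)
  ultimately show ?thesis by blast
qed

text \<open>Eigenvectors of distinct eigenvalues are orthogonal, hence independent. Finiteness is
  what gives the \<open>Max\<close> in \<open>lambda_max\<close> its meaning.\<close>

lemma finite_eigenvalues_self_adjoint:
  fixes f :: "'a::euclidean_space \<Rightarrow> 'a"
  assumes sa: "\<And>u v. f u \<bullet> v = u \<bullet> f v"
  shows "finite {c. \<exists>v. v \<noteq> 0 \<and> f v = c *\<^sub>R v}" (is "finite ?E")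
proof -
  define E where "E = ?E"
  define v where "v c = (SOME v. v \<noteq> 0 \<and> f v = c *\<^sub>R v)" for c
  have "v c \<noteq> 0 \<and> f (v c) = c *\<^sub>R v c" if "c \<in> E" for c
    unfolding v_def by (rule someI_ex) (use that[unfolded E_def] in \<open>rule CollectD\<close>)
  then have v0: "v c \<noteq> 0" and fv: "f (v c) = c *\<^sub>R v c" if "c \<in> E" for c
    using that by auto
  have orth: "v c \<bullet> v d = 0" if "c \<in> E" "d \<in> E" "c \<noteq> d" for c d
  proof -
    have "c * (v c \<bullet> v d) = d * (v c \<bullet> v d)"
      using sa[of "v c" "v d"] unfolding fv[OF that(1)] fv[OF that(2)] by simp
    then show ?thesis using that(3) by (metis mult_cancel_right)
  qed
  have inj: "inj_on v E"
  proof (rule inj_onI, rule ccontr)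
    fix c d assume cd: "c \<in> E" "d \<in> E" "v c = v d" "c \<noteq> d"
    show False using orth[OF cd(1,2,4)] v0[OF cd(2)] unfolding cd(3) by simp
  qed
  have "pairwise orthogonal (v ` E)"
    unfolding pairwise_def orthogonal_def
  proof (intro ballI impI)
    fix x y assume "x \<in> v ` E" "y \<in> v ` E" and ne: "x \<noteq> y"
    then obtain c d where cd: "x = v c" "y = v d" "c \<in> E" "d \<in> E" by (elim imageE)
    from ne cd(1,2) have "c \<noteq> d" by metis
    from orth[OF cd(3,4) this] show "x \<bullet> y = 0" unfolding cd(1,2) .
  qed
  moreover have "0 \<notin> v ` E" using v0 by (metis imageE)
  ultimately have "finite (v ` E)"
    by (intro independent_imp_finite pairwise_orthogonal_independent)
  with inj have "finite E" by (simp add: finite_image_iff)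
  then show ?thesis unfolding E_def .
qed

text \<open>The top eigenvalue \<open>c\<close> of the Rayleigh argument belongs to the set whose
  \<open>Max\<close> is taken, so \<open>lambda_max\<close> dominates the quadratic form
  \<open>(norm (B *v w))\<^sup>2\<close>. Evaluating the bound at a nonzero vector gives the
  sign.\<close>

lemma lambda_max_gram:
  fixes B :: "real^'m^'k"
  shows norm_matrix_vector_le_lambda_max: "(norm (B *v v))\<^sup>2 \<le> lambda_max (transpose B ** B) * (norm v)\<^sup>2"
    and lambda_max_gram_nonneg: "0 \<le> lambda_max (transpose B ** B)"
proof -
  let ?f = "(*v) (transpose B ** B)"
  have q: "u \<bullet> ?f w = (B *v u) \<bullet> (B *v w)" for u w
    using inner_transpose_matrix_vector[of B "B *v w" u]
    by (simp only: matrix_vector_mul_assoc inner_commute)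
  then have sa: "?f u \<bullet> w = u \<bullet> ?f w" for u w
    by (simp only: inner_commute[of "?f u"] q inner_commute[of "B *v w"])
  have lin: "linear ?f" by simp
  from self_adjoint_top_eigenvector[OF lin sa]
  obtain c u where c: "u \<noteq> 0" "?f u = c *\<^sub>R u" and top: "\<And>w. w \<bullet> ?f w \<le> c * (norm w)\<^sup>2"
    by (elim exE conjE) simp
  have le: "c \<le> lambda_max (transpose B ** B)"
    unfolding lambda_max_def
  proof (rule Max_ge[OF finite_eigenvalues_self_adjoint[OF sa]])
    show "c \<in> {c. \<exists>v. v \<noteq> 0 \<and> ?f v = c *\<^sub>R v}"
      by (rule CollectI, rule exI[of _ u], rule conjI[OF c])
  qed
  have bound: "(norm (B *v v))\<^sup>2 \<le> lambda_max (transpose B ** B) * (norm v)\<^sup>2" for v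
  proof -
    have "(norm (B *v v))\<^sup>2 = v \<bullet> ?f v" by (simp only: q power2_norm_eq_inner)
    also have "\<dots> \<le> c * (norm v)\<^sup>2" by (rule top)
    also have "\<dots> \<le> lambda_max (transpose B ** B) * (norm v)\<^sup>2"
      using le by (simp add: mult_right_mono)
    finally show ?thesis .
  qed
  from bound[of u] have "0 * (norm u)\<^sup>2 \<le> lambda_max (transpose B ** B) * (norm u)\<^sup>2"
    unfolding mult_zero_left by (rule order_trans[OF zero_le_power2])
  moreover have "0 < (norm u)\<^sup>2" using c(1) by simp
  ultimately show "0 \<le> lambda_max (transpose B ** B)"
    by (rule mult_right_le_imp_le)
  show "(norm (B *v v))\<^sup>2 \<le> lambda_max (transpose B ** B) * (norm v)\<^sup>2"
    by (rule bound)
qed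

text \<open>Test \<open>transpose B *v u\<close> against itself and cancel one factor of its norm.
  In this way \<open>lambda_max (transpose A ** A)\<close> controls \<open>A\<close> and its
  transpose alike.\<close>

lemma norm_transpose_matrix_vector_le:
  fixes B :: "real^'m^'k"
  assumes "0 \<le> c" and B: "\<And>v. norm (B *v v) \<le> c * norm v"
  shows "norm (transpose B *v u) \<le> c * norm u"
proof (cases "transpose B *v u = 0")
  case False
  let ?w = "transpose B *v u"
  have "norm ?w * norm ?w = u \<bullet> (B *v ?w)"
    using inner_transpose_matrix_vector[of B u ?w] by (simp add: dot_square_norm power2_eq_square)
  also have "\<dots> \<le> norm u * (c * norm ?w)"
    using norm_cauchy_schwarz[of u "B *v ?w"] mult_left_mono[OF B[of ?w] norm_ge_zero[of u]]
    by linarith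
  finally have "norm ?w * norm ?w \<le> c * norm u * norm ?w" by (simp add: mult_ac)
  then show ?thesis using False by (simp only: mult_le_cancel_right) simp
qed (use assms(1) in simp)

section \<open>Gradients of functions on a linear subspace\<close>

text \<open>The line \<open>u + t h\<close> stays in \<open>S\<close>, so the problem becomes
  one-dimensional. The right-hand limit is the form in which convexity, which controls small
  positive \<open>t\<close>, can be applied.\<close>

lemma has_derivative_within_subspace_direction:
  fixes f :: "'a::real_normed_vector \<Rightarrow> real"
  assumes S: "subspace S" "u \<in> S" "h \<in> S" and f: "(f has_derivative f') (at u within S)"
  shows "((\<lambda>t. (f (u + t *\<^sub>R h) - f u) / t) \<longlongrightarrow> f' h) (at_right 0)"
proof -
  have 1: "((\<lambda>t. u + t *\<^sub>R h) has_derivative (\<lambda>t. t *\<^sub>R h)) (at 0)"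
    by (auto intro!: derivative_eq_intros)
  have "(f has_derivative f') (at (u + 0 *\<^sub>R h) within range (\<lambda>t. u + t *\<^sub>R h))"
  proof (rule has_derivative_subset)
    show "(f has_derivative f') (at (u + 0 *\<^sub>R h) within S)" using f by simp
  qed (use S in \<open>auto intro: subspace_add subspace_scale\<close>)
  from has_derivative_in_compose[OF 1 this]
  have "((\<lambda>t. f (u + t *\<^sub>R h)) has_derivative (\<lambda>t. t * f' h)) (at 0)"
    by (simp add: linear_scale[OF has_derivative_linear[OF f]])
  then have "((\<lambda>t. f (u + t *\<^sub>R h)) has_field_derivative f' h) (at 0)"
    by (simp add: has_field_derivative_def mult.commute[of _ "f' h"])
  then show ?thesis
    unfolding has_field_derivative_iff by (simp add: filterlim_at_split)
qed

text \<open>Existence: \<open>adjoint f' 1\<close> represents \<open>f'\<close> on the whole space,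
  and its orthogonal projection to \<open>S\<close> represents the same functional on
  \<open>S\<close>. Uniqueness: two candidates have equal directional derivatives along their
  difference, which lies in \<open>S\<close>.\<close>

lemma ex1_gradient_on:
  fixes f :: "'a::euclidean_space \<Rightarrow> real"
  assumes S: "subspace S" and u: "u \<in> S" and f: "f differentiable (at u within S)"
  shows "\<exists>!g. g \<in> S \<and> (f has_derivative (\<lambda>h. g \<bullet> h)) (at u within S)"
proof (rule ex_ex1I)
  obtain f' where f': "(f has_derivative f') (at u within S)"
    using f by (auto simp: differentiable_def)
  then have lin: "linear f'" by (rule has_derivative_linear)
  obtain g z where g: "g \<in> span S" and z: "\<And>w. w \<in> span S \<Longrightarrow> orthogonal z w"
    and gz: "adjoint f' (1::real) = g + z"
    using orthogonal_subspace_decomp_exists[of S "adjoint f' (1::real)"] by metis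
  have gS: "g \<in> S" using g S by (simp add: span_eq_iff[THEN iffD2])
  have eq: "g \<bullet> h = f' h" if "h \<in> S" for h
  proof -
    have "f' h = adjoint f' (1::real) \<bullet> h"
      using adjoint_works[OF lin, of h 1] by (simp add: inner_commute)
    then show ?thesis
      using z[of h] that by (simp add: gz inner_add_left orthogonal_def span_base)
  qed
  have "(f has_derivative (\<lambda>h. g \<bullet> h)) (at u within S)"
    unfolding has_derivative_within
  proof
    show "bounded_linear ((\<bullet>) g)" by (rule bounded_linear_inner_right)
    show "((\<lambda>y. (1 / norm (y - u)) *\<^sub>R (f y - (f u + g \<bullet> (y - u)))) \<longlongrightarrow> 0) (at u within S)"
    proof (rule Lim_transform_eventually)
      show "((\<lambda>y. (1 / norm (y - u)) *\<^sub>R (f y - (f u + f' (y - u)))) \<longlongrightarrow> 0) (at u within S)"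
        using f' by (simp add: has_derivative_within)
      show "\<forall>\<^sub>F y in at u within S. (1 / norm (y - u)) *\<^sub>R (f y - (f u + f' (y - u))) =
          (1 / norm (y - u)) *\<^sub>R (f y - (f u + g \<bullet> (y - u)))"
        unfolding eventually_at_filter
        by (rule always_eventually) (simp add: eq subspace_diff[OF S _ u])
    qed
  qed
  with gS show "\<exists>g. g \<in> S \<and> (f has_derivative (\<lambda>h. g \<bullet> h)) (at u within S)" by blast
next
  fix g g' assume a: "g \<in> S \<and> (f has_derivative (\<lambda>h. g \<bullet> h)) (at u within S)"
    "g' \<in> S \<and> (f has_derivative (\<lambda>h. g' \<bullet> h)) (at u within S)"
  then have "g - g' \<in> S" using S by (simp add: subspace_diff)
  note lim = has_derivative_within_subspace_direction[OF S u this]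
  have "g \<bullet> (g - g') = g' \<bullet> (g - g')"
    by (rule tendsto_unique[OF trivial_limit_at_right_real lim[OF conjunct2[OF a(1)]]
          lim[OF conjunct2[OF a(2)]]])
  then have "(g - g') \<bullet> (g - g') = 0" by (simp add: inner_diff_left)
  then show "g = g'" by simp
qed

lemma gradient_on:
  fixes f :: "'a::euclidean_space \<Rightarrow> real"
  assumes "subspace S" "u \<in> S" "f differentiable_on S"
  shows gradient_on_mem: "gradient_on S f u \<in> S"
    and has_derivative_gradient_on:
      "(f has_derivative (\<lambda>h. gradient_on S f u \<bullet> h)) (at u within S)"
  using theI'[OF ex1_gradient_on[OF assms(1,2)]] assms(2,3)
  by (auto simp: gradient_on_def differentiable_on_def)

text \<open>Secant slopes from \<open>u\<close> towards \<open>v\<close> are at most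
  \<open>f v - f u\<close>, and the derivative is their limit.\<close>

lemma convex_on_gradient_on_le:
  fixes f :: "'a::euclidean_space \<Rightarrow> real"
  assumes S: "subspace S" and u: "u \<in> S" and v: "v \<in> S"
    and diff: "f differentiable_on S" and conv: "convex_on S f"
  shows "f u + gradient_on S f u \<bullet> (v - u) \<le> f v"
proof -
  have lim: "((\<lambda>t. (f (u + t *\<^sub>R (v - u)) - f u) / t) \<longlongrightarrow> gradient_on S f u \<bullet> (v - u)) (at_right 0)"
    by (rule has_derivative_within_subspace_direction[OF S u subspace_diff[OF S v u]])
      (rule has_derivative_gradient_on[OF S u diff])
  have "\<forall>\<^sub>F t in at_right 0. (f (u + t *\<^sub>R (v - u)) - f u) / t \<le> f v - f u"
    unfolding eventually_at_right_field
  proof (intro exI[of _ 1] conjI allI impI)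
    fix t :: real assume t: "0 < t" "t < 1"
    have "f ((1 - t) *\<^sub>R u + t *\<^sub>R v) \<le> (1 - t) * f u + t * f v"
      using conv u v t by (intro convex_onD) auto
    moreover have "(1 - t) *\<^sub>R u + t *\<^sub>R v = u + t *\<^sub>R (v - u)" by (simp add: algebra_simps)
    ultimately have "f (u + t *\<^sub>R (v - u)) - f u \<le> t * (f v - f u)"
      by (simp only:) (simp add: algebra_simps)
    then show "(f (u + t *\<^sub>R (v - u)) - f u) / t \<le> f v - f u"
      using t by (simp add: divide_le_eq mult.commute)
  qed simp
  from tendsto_upperbound[OF lim this trivial_limit_at_right_real] show ?thesis by linarith
qed

section \<open>Stochastic extragradient iterations\<close>

text \<open>Young's inequality, from \<open>0 \<le> (norm (t a - b))\<^sup>2 / t\<close>. The weight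
  stays free because both 1 and 1/7 are used.\<close>

lemma norm_add_sq_le_weighted:
  fixes a b :: "'a::real_inner"
  assumes "0 < t"
  shows "(norm (a + b))\<^sup>2 \<le> (1 + t) * (norm a)\<^sup>2 + (1 + 1 / t) * (norm b)\<^sup>2"
proof -
  have "0 \<le> (norm (t *\<^sub>R a - b))\<^sup>2 / t" using assms by simp
  also have "\<dots> = t * (norm a)\<^sup>2 - 2 * (a \<bullet> b) + (norm b)\<^sup>2 / t"
    using assms unfolding power2_norm_eq_inner
    by (simp add: inner_diff inner_commute field_simps power2_eq_square)
  finally have "2 * (a \<bullet> b) \<le> t * (norm a)\<^sup>2 + (norm b)\<^sup>2 / t" by simp
  moreover have "(norm (a + b))\<^sup>2 = (norm a)\<^sup>2 + 2 * (a \<bullet> b) + (norm b)\<^sup>2"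
    unfolding power2_norm_eq_inner by (simp add: inner_add inner_commute)
  ultimately show ?thesis by (simp add: algebra_simps)
qed

text \<open>With \<open>G\<close> and \<open>H\<close> the noisy operator values at \<open>q\<close>
  and \<open>p\<close>, the difference of the squared distances is exactly \<open>2 \<gamma> (G
  \<bullet> (q - u)) + \<gamma>\<^sup>2 (norm H)\<^sup>2 - \<gamma>\<^sup>2 (norm (G -
  H))\<^sup>2\<close>, and \<open>\<gamma> H = p - q\<close>. Only the last square needs an
  estimate.\<close>

lemma extragradient_step:
  fixes p :: "'a::real_inner"
  assumes contr: "\<gamma>\<^sup>2 * (norm (F p - F q))\<^sup>2 \<le> 7 / 8 * (norm (p - q))\<^sup>2"
    and q: "q = p - \<gamma> *\<^sub>R (F p + n)" and p': "p' = p - \<gamma> *\<^sub>R (F q + m)"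
  shows "2 * \<gamma> * ((F q + m) \<bullet> (q - u)) \<le>
    (norm (p - u))\<^sup>2 - (norm (p' - u))\<^sup>2 + 8 * \<gamma>\<^sup>2 * (norm (m - n))\<^sup>2"
proof -
  define G H where "G = F q + m" and "H = F p + n"
  have pq: "p - q = \<gamma> *\<^sub>R H" by (simp add: q H_def)
  have "p' - u = (q - u) + \<gamma> *\<^sub>R (H - G)" "p - u = (q - u) + \<gamma> *\<^sub>R H"
    using pq by (simp_all add: p' G_def algebra_simps)
  then have "(norm (p - u))\<^sup>2 - (norm (p' - u))\<^sup>2 =
      2 * \<gamma> * (G \<bullet> (q - u)) + \<gamma>\<^sup>2 * (norm H)\<^sup>2 - \<gamma>\<^sup>2 * (norm (G - H))\<^sup>2"
    unfolding power2_norm_eq_inner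
    by (simp only:) (simp add: inner_add inner_diff inner_commute power2_eq_square algebra_simps)
  moreover have "\<gamma>\<^sup>2 * (norm H)\<^sup>2 = (norm (p - q))\<^sup>2"
    by (simp add: pq power_mult_distrib)
  moreover have "\<gamma>\<^sup>2 * (norm (G - H))\<^sup>2 \<le> (norm (p - q))\<^sup>2 + 8 * \<gamma>\<^sup>2 * (norm (m - n))\<^sup>2"
  proof -
    have "(norm (G - H))\<^sup>2 = (norm ((F q - F p) + (m - n)))\<^sup>2"
      by (simp add: G_def H_def algebra_simps)
    \<comment> \<open>The weight 1/7 is chosen because \<open>8/7 * 7/8 = 1\<close>: the operator
      part is absorbed exactly by \<open>(norm (p - q))\<^sup>2\<close>, and the noise pays the
      factor 8.\<close>
    also have "\<dots> \<le> 8 / 7 * (norm (F p - F q))\<^sup>2 + 8 * (norm (m - n))\<^sup>2"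
      using norm_add_sq_le_weighted[of "1 / 7" "F q - F p" "m - n"] by (simp add: norm_minus_commute)
    finally have "\<gamma>\<^sup>2 * (norm (G - H))\<^sup>2 \<le>
        \<gamma>\<^sup>2 * (8 / 7 * (norm (F p - F q))\<^sup>2 + 8 * (norm (m - n))\<^sup>2)"
      by (rule mult_left_mono) simp
    also have "\<dots> \<le> (norm (p - q))\<^sup>2 + 8 * \<gamma>\<^sup>2 * (norm (m - n))\<^sup>2"
      using contr by (simp add: algebra_simps)
    finally show ?thesis .
  qed
  ultimately show ?thesis unfolding G_def[symmetric] by linarith
qed

text \<open>An arbitrary operator and a fixed noise path: the regret bound is deterministic, and
  probability enters only when its noise terms are averaged.\<close>

primrec extragradient ::
  "('a::real_vector \<Rightarrow> 'a) \<Rightarrow> real \<Rightarrow> 'a \<Rightarrow> (nat \<Rightarrow> stage \<Rightarrow> 'a) \<Rightarrow> nat \<Rightarrow> 'a" where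
  "extragradient F \<gamma> p0 e 0 = p0"
| "extragradient F \<gamma> p0 e (Suc k) =
     (let p = extragradient F \<gamma> p0 e k; q = p - \<gamma> *\<^sub>R (F p + e k Full)
      in p - \<gamma> *\<^sub>R (F q + e k Half))"

definition extragradient_half ::
  "('a::real_vector \<Rightarrow> 'a) \<Rightarrow> real \<Rightarrow> 'a \<Rightarrow> (nat \<Rightarrow> stage \<Rightarrow> 'a) \<Rightarrow> nat \<Rightarrow> 'a" where
  "extragradient_half F \<gamma> p0 e k =
     (let p = extragradient F \<gamma> p0 e k in p - \<gamma> *\<^sub>R (F p + e k Full))"

lemma extragradient_cong:
  assumes "\<And>j h. j < k \<Longrightarrow> e j h = e' j h"
  shows "extragradient F \<gamma> p0 e k = extragradient F \<gamma> p0 e' k"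
  using assms by (induction k) (simp_all add: Let_def)

text \<open>The half iterate reads the earlier noise and \<open>e k Full\<close>, but not
  \<open>e k Half\<close>. This is the source of the independence used in
  \<open>expectation_noise_inner_half_eq_0\<close>.\<close>

lemma extragradient_half_cong:
  assumes "\<And>j h. j < k \<Longrightarrow> e j h = e' j h" "e k Full = e' k Full"
  shows "extragradient_half F \<gamma> p0 e k = extragradient_half F \<gamma> p0 e' k"
  using extragradient_cong[of k e e'] assms by (simp add: extragradient_half_def)

text \<open>The comparison point \<open>u\<close> occurs on the right only in the first summand. The
  bound can therefore be maximised over \<open>u\<close> path by path, before any expectation is
  taken.\<close>

lemma extragradient_regret:
  fixes F :: "'a::real_inner \<Rightarrow> 'a" and p0 :: 'a and e :: "nat \<Rightarrow> stage \<Rightarrow> 'a"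
  assumes contr: "\<And>p q. \<gamma>\<^sup>2 * (norm (F p - F q))\<^sup>2 \<le> 7 / 8 * (norm (p - q))\<^sup>2"
    and "0 < \<gamma>"
  defines "q \<equiv> extragradient_half F \<gamma> p0 e"
  shows "(\<Sum>k<K. F (q k) \<bullet> (q k - u)) \<le> 3 / (4 * \<gamma>) * (norm (p0 - u))\<^sup>2 +
    (8 * \<gamma> * (\<Sum>k<K. (norm (e k Half))\<^sup>2 + (norm (e k Full))\<^sup>2) +
     \<gamma> * (norm (\<Sum>k<K. e k Half))\<^sup>2 - (\<Sum>k<K. e k Half \<bullet> (q k - p0)))"
proof -
  let ?p = "extragradient F \<gamma> p0 e"
  have step: "2 * \<gamma> * ((F (q k) + e k Half) \<bullet> (q k - u)) \<le>
      (norm (?p k - u))\<^sup>2 - (norm (?p (Suc k) - u))\<^sup>2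
      + 16 * \<gamma>\<^sup>2 * ((norm (e k Half))\<^sup>2 + (norm (e k Full))\<^sup>2)" for k
  proof -
    have "(norm (e k Half - e k Full))\<^sup>2 \<le> 2 * ((norm (e k Half))\<^sup>2 + (norm (e k Full))\<^sup>2)"
      using norm_add_sq_le_weighted[of 1 "e k Half" "- e k Full"] by simp
    then have "8 * \<gamma>\<^sup>2 * (norm (e k Half - e k Full))\<^sup>2 \<le>
        8 * \<gamma>\<^sup>2 * (2 * ((norm (e k Half))\<^sup>2 + (norm (e k Full))\<^sup>2))"
      by (rule mult_left_mono) simp
    moreover have "2 * \<gamma> * ((F (q k) + e k Half) \<bullet> (q k - u)) \<le>
        (norm (?p k - u))\<^sup>2 - (norm (?p (Suc k) - u))\<^sup>2 + 8 * \<gamma>\<^sup>2 * (norm (e k Half - e k Full))\<^sup>2"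
      by (rule extragradient_step[OF contr])
        (simp_all add: q_def extragradient_half_def Let_def)
    ultimately show ?thesis by linarith
  qed
  have "2 * \<gamma> * (\<Sum>k<K. (F (q k) + e k Half) \<bullet> (q k - u)) \<le>
      (norm (?p 0 - u))\<^sup>2 - (norm (?p K - u))\<^sup>2
      + 16 * \<gamma>\<^sup>2 * (\<Sum>k<K. (norm (e k Half))\<^sup>2 + (norm (e k Full))\<^sup>2)"
  proof (induction K)
    case (Suc K)
    then show ?case using step[of K] by (simp add: distrib_left)
  qed simp
  also have "\<dots> \<le> (norm (p0 - u))\<^sup>2
      + 16 * \<gamma>\<^sup>2 * (\<Sum>k<K. (norm (e k Half))\<^sup>2 + (norm (e k Full))\<^sup>2)" by simp
  finally have "(\<Sum>k<K. (F (q k) + e k Half) \<bullet> (q k - u)) \<le> (norm (p0 - u))\<^sup>2 / (2 * \<gamma>)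
      + 8 * \<gamma> * (\<Sum>k<K. (norm (e k Half))\<^sup>2 + (norm (e k Full))\<^sup>2)"
    using \<open>0 < \<gamma>\<close> by (simp add: field_simps power2_eq_square)
  \<comment> \<open>Splitting at the deterministic \<open>p0\<close> separates a sum that does not
    involve \<open>u\<close> from one in which \<open>u\<close> meets only the total noise.\<close>
  moreover have "(\<Sum>k<K. (F (q k) + e k Half) \<bullet> (q k - u)) =
      (\<Sum>k<K. F (q k) \<bullet> (q k - u)) + (\<Sum>k<K. e k Half \<bullet> (q k - p0))
      + (\<Sum>k<K. e k Half) \<bullet> (p0 - u)"
    unfolding inner_sum_left sum.distrib[symmetric]
    by (rule sum.cong) (simp_all add: inner_add_left inner_diff_right)
  moreover have "- ((\<Sum>k<K. e k Half) \<bullet> (p0 - u)) \<le>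
      \<gamma> * (norm (\<Sum>k<K. e k Half))\<^sup>2 + (norm (p0 - u))\<^sup>2 / (4 * \<gamma>)"
  proof -
    define S where "S = (\<Sum>k<K. e k Half)"
    \<comment> \<open>Scaled so that the cross term is exactly
      \<open>S \<bullet> (p0 - u)\<close>.\<close>
    have "0 \<le> (norm (2 *\<^sub>R \<gamma> *\<^sub>R S + (p0 - u)))\<^sup>2 / (4 * \<gamma>)" using \<open>0 < \<gamma>\<close> by simp
    also have "\<dots> = \<gamma> * (norm S)\<^sup>2 + S \<bullet> (p0 - u) + (norm (p0 - u))\<^sup>2 / (4 * \<gamma>)"
      using \<open>0 < \<gamma>\<close> unfolding power2_norm_eq_inner inner_add inner_scaleR_left inner_scaleR_right
      by (simp add: inner_commute field_simps power2_eq_square)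
    finally show ?thesis by (simp add: S_def)
  qed
  moreover have "3 / (4 * \<gamma>) * (norm (p0 - u))\<^sup>2 =
      (norm (p0 - u))\<^sup>2 / (2 * \<gamma>) + (norm (p0 - u))\<^sup>2 / (4 * \<gamma>)"
    using \<open>0 < \<gamma>\<close> by (simp add: field_simps)
  ultimately show ?thesis by linarith
qed

section \<open>Square-integrable random vectors\<close>

text \<open>Measurability is a separate conjunct because integrability of the squared norm does not
  imply it.\<close>

definition square_integrable :: "'w measure \<Rightarrow> ('w \<Rightarrow> 'a::euclidean_space) \<Rightarrow> bool" where
  "square_integrable M X \<longleftrightarrow> X \<in> borel_measurable M \<and> integrable M (\<lambda>\<omega>. (norm (X \<omega>))\<^sup>2)"

lemma square_integrable_bound:
  assumes "X \<in> borel_measurable M" "integrable M g" "\<And>\<omega>. (norm (X \<omega>))\<^sup>2 \<le> g \<omega>"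
  shows "square_integrable M X"
  unfolding square_integrable_def
proof
  show "integrable M (\<lambda>\<omega>. (norm (X \<omega>))\<^sup>2)"
    by (rule Bochner_Integration.integrable_bound[OF assms(2)])
      (use assms in \<open>auto intro!: AE_I2 order_trans[OF _ abs_ge_self]\<close>)
qed fact

lemma square_integrable_add:
  assumes "square_integrable M X" "square_integrable M Y"
  shows "square_integrable M (\<lambda>\<omega>. X \<omega> + Y \<omega>)"
  by (rule square_integrable_bound[where g = "\<lambda>\<omega>. 2 * (norm (X \<omega>))\<^sup>2 + 2 * (norm (Y \<omega>))\<^sup>2"])
    (use assms norm_add_sq_le_weighted[of 1] in \<open>auto simp: square_integrable_def\<close>)

lemma square_integrable_scaleR:
  assumes "square_integrable M X"
  shows "square_integrable M (\<lambda>\<omega>. c *\<^sub>R X \<omega>)"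
  using assms by (auto simp: square_integrable_def power_mult_distrib)

lemma square_integrable_diff:
  assumes "square_integrable M X" "square_integrable M Y"
  shows "square_integrable M (\<lambda>\<omega>. X \<omega> - Y \<omega>)"
  using square_integrable_add[OF assms(1) square_integrable_scaleR[OF assms(2), of "-1"]] by simp

lemma (in finite_measure) square_integrable_const: "square_integrable M (\<lambda>_. c)"
  by (simp add: square_integrable_def)

lemma (in finite_measure) square_integrable_sum:
  "(\<And>i. i \<in> I \<Longrightarrow> square_integrable M (X i)) \<Longrightarrow> square_integrable M (\<lambda>\<omega>. \<Sum>i\<in>I. X i \<omega>)"
  by (induction I rule: infinite_finite_induct)
    (simp_all add: square_integrable_const square_integrable_add)

text \<open>A Lipschitz map grows at most linearly, and the constant \<open>F 0\<close> is
  integrable on a finite measure space.\<close>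

lemma (in finite_measure) square_integrable_lipschitz:
  fixes F :: "'b::euclidean_space \<Rightarrow> 'c::euclidean_space"
  assumes F: "L-lipschitz_on UNIV F" and X: "square_integrable M X"
  shows "square_integrable M (\<lambda>\<omega>. F (X \<omega>))"
proof (rule square_integrable_bound)
  have "F \<in> borel_measurable borel"
    using lipschitz_on_continuous_on[OF F] by (rule borel_measurable_continuous_onI)
  then show "(\<lambda>\<omega>. F (X \<omega>)) \<in> borel_measurable M"
    using X by (auto simp: square_integrable_def)
  show "integrable M (\<lambda>\<omega>. 2 * (L\<^sup>2 * (norm (X \<omega>))\<^sup>2) + 2 * (norm (F 0))\<^sup>2)"
    using X by (auto simp: square_integrable_def)
  show "(norm (F (X \<omega>)))\<^sup>2 \<le> 2 * (L\<^sup>2 * (norm (X \<omega>))\<^sup>2) + 2 * (norm (F 0))\<^sup>2" for \<omega>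
  proof -
    have "norm (F (X \<omega>) - F 0) \<le> L * norm (X \<omega>)"
      using lipschitz_onD[OF F, of "X \<omega>" 0] by (simp add: dist_norm)
    then have "(norm (F (X \<omega>) - F 0))\<^sup>2 \<le> L\<^sup>2 * (norm (X \<omega>))\<^sup>2"
      by (metis norm_ge_zero power_mono power_mult_distrib)
    then show ?thesis
      using norm_add_sq_le_weighted[of 1 "F (X \<omega>) - F 0" "F 0"] by simp
  qed
qed

lemma square_integrable_inner:
  assumes "square_integrable M X" "square_integrable M Y"
  shows "integrable M (\<lambda>\<omega>. X \<omega> \<bullet> Y \<omega>)"
proof (rule Bochner_Integration.integrable_bound)
  show "integrable M (\<lambda>\<omega>. (norm (X \<omega>))\<^sup>2 + (norm (Y \<omega>))\<^sup>2)"
    using assms by (auto simp: square_integrable_def)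
  show "AE \<omega> in M. norm (X \<omega> \<bullet> Y \<omega>) \<le> norm ((norm (X \<omega>))\<^sup>2 + (norm (Y \<omega>))\<^sup>2)"
  proof (rule AE_I2)
    fix \<omega>
    have "\<bar>X \<omega> \<bullet> Y \<omega>\<bar> \<le> norm (X \<omega>) * norm (Y \<omega>)" by (rule Cauchy_Schwarz_ineq2)
    moreover have "2 * (norm (X \<omega>) * norm (Y \<omega>)) \<le> (norm (X \<omega>))\<^sup>2 + (norm (Y \<omega>))\<^sup>2"
      using sum_squares_bound[of "norm (X \<omega>)" "norm (Y \<omega>)"] by simp
    moreover have "0 \<le> norm (X \<omega>) * norm (Y \<omega>)" by simp
    ultimately show "norm (X \<omega> \<bullet> Y \<omega>) \<le> norm ((norm (X \<omega>))\<^sup>2 + (norm (Y \<omega>))\<^sup>2)"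
      by simp
  qed
qed (use assms in \<open>auto simp: square_integrable_def\<close>)

lemma (in finite_measure) square_integrable_integrable:
  fixes X :: "'a \<Rightarrow> 'b::euclidean_space"
  assumes "square_integrable M X"
  shows "integrable M X"
proof -
  have "integrable M (\<lambda>\<omega>. X \<omega> \<bullet> i)" for i
    by (rule square_integrable_inner[OF assms square_integrable_const])
  then have "integrable M (\<lambda>\<omega>. \<Sum>i\<in>Basis. (X \<omega> \<bullet> i) *\<^sub>R i)" by auto
  then show ?thesis by (simp add: euclidean_representation)
qed

text \<open>In coordinates, the product rule for independent real variables applies to each summand,
  and the factor from \<open>X\<close> has mean zero.\<close>

lemma (in prob_space) expectation_inner_indep_eq_0:
  fixes X Y :: "'a \<Rightarrow> 'b::euclidean_space"
  assumes ind: "indep_var borel X borel Y"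
    and X: "square_integrable M X" and Y: "square_integrable M Y" and "expectation X = 0"
  shows "expectation (\<lambda>\<omega>. X \<omega> \<bullet> Y \<omega>) = 0"
proof -
  have int: "integrable M (\<lambda>\<omega>. X \<omega> \<bullet> i)" "integrable M (\<lambda>\<omega>. Y \<omega> \<bullet> i)" for i
    by (rule square_integrable_inner[OF _ square_integrable_const], fact)+
  have ind': "indep_var borel (\<lambda>\<omega>. X \<omega> \<bullet> i) borel (\<lambda>\<omega>. Y \<omega> \<bullet> i)" for i
    using indep_var_compose[OF ind, of "\<lambda>x. x \<bullet> i" borel "\<lambda>x. x \<bullet> i" borel] by (simp add: o_def)
  have "expectation (\<lambda>\<omega>. X \<omega> \<bullet> Y \<omega>) = expectation (\<lambda>\<omega>. \<Sum>i\<in>Basis. (X \<omega> \<bullet> i) * (Y \<omega> \<bullet> i))"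
    by (subst euclidean_inner) simp
  also have "\<dots> = (\<Sum>i\<in>Basis. expectation (\<lambda>\<omega>. (X \<omega> \<bullet> i) * (Y \<omega> \<bullet> i)))"
    by (rule Bochner_Integration.integral_sum) (rule indep_var_integrable[OF ind' int])
  also have "\<dots> = (\<Sum>i\<in>Basis. (expectation X \<bullet> i) * expectation (\<lambda>\<omega>. Y \<omega> \<bullet> i))"
    using square_integrable_integrable[OF X]
    by (simp add: indep_var_lebesgue_integral[OF ind' int])
  finally show ?thesis using assms(4) by simp
qed

lemma (in prob_space) indep_vars_imp_indep_var:
  assumes "indep_vars N X I" "i \<in> I" "j \<in> I" "i \<noteq> j"
  shows "indep_var (N i) (X i) (N j) (X j)"
proof -
  have "indep_var (PiM {i} N) (\<lambda>\<omega>. restrict (\<lambda>k. X k \<omega>) {i}) (PiM {j} N) (\<lambda>\<omega>. restrict (\<lambda>k. X k \<omega>) {j})"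
    by (rule indep_var_restrict[OF assms(1)]) (use assms in auto)
  from indep_var_compose[OF this measurable_component_singleton measurable_component_singleton, of i j]
  show ?thesis by (simp add: o_def)
qed

text \<open>The cross terms vanish, so the second moment of a noise sum grows linearly, not
  quadratically, in the number of terms.\<close>

lemma (in prob_space) expectation_norm_sum_indep:
  fixes X :: "'i \<Rightarrow> 'a \<Rightarrow> 'b::euclidean_space"
  assumes ind: "indep_vars (\<lambda>_. borel) X I" and "finite I"
    and X: "\<And>i. i \<in> I \<Longrightarrow> square_integrable M (X i)"
    and zero: "\<And>i. i \<in> I \<Longrightarrow> expectation (X i) = 0"
  shows "expectation (\<lambda>\<omega>. (norm (\<Sum>i\<in>I. X i \<omega>))\<^sup>2) = (\<Sum>i\<in>I. expectation (\<lambda>\<omega>. (norm (X i \<omega>))\<^sup>2))"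
proof -
  have "expectation (\<lambda>\<omega>. (norm (\<Sum>i\<in>I. X i \<omega>))\<^sup>2) =
      expectation (\<lambda>\<omega>. \<Sum>i\<in>I. \<Sum>j\<in>I. X i \<omega> \<bullet> X j \<omega>)"
    by (simp add: power2_norm_eq_inner inner_sum_left inner_sum_right) (simp only: inner_commute)
  also have "\<dots> = (\<Sum>i\<in>I. \<Sum>j\<in>I. expectation (\<lambda>\<omega>. X i \<omega> \<bullet> X j \<omega>))"
    by (subst Bochner_Integration.integral_sum)
      (auto intro!: sum.cong Bochner_Integration.integral_sum Bochner_Integration.integrable_sum
        square_integrable_inner X)
  also have "\<dots> = (\<Sum>i\<in>I. \<Sum>j\<in>I. if j = i then expectation (\<lambda>\<omega>. (norm (X i \<omega>))\<^sup>2) else 0)"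
  proof (intro sum.cong refl)
    fix i j assume "i \<in> I" "j \<in> I"
    then show "expectation (\<lambda>\<omega>. X i \<omega> \<bullet> X j \<omega>) =
        (if j = i then expectation (\<lambda>\<omega>. (norm (X i \<omega>))\<^sup>2) else 0)"
      using expectation_inner_indep_eq_0[OF indep_vars_imp_indep_var[OF ind, of i j]] X zero
      by (auto simp: power2_norm_eq_inner)
  qed
  finally show ?thesis using \<open>finite I\<close> by simp
qed

section \<open>Random extragradient iterates and their expected noise terms\<close>

text \<open>The measure space is arbitrary so that the lemma also covers the coordinate maps of a
  product space, where the iterate is a function of the noise path.\<close>

lemma extragradient_measurable:
  fixes F :: "'a::euclidean_space \<Rightarrow> 'a"
  assumes [measurable]: "F \<in> borel_measurable borel"
    and "\<And>j h. j < k \<Longrightarrow> N j h \<in> borel_measurable M"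
  shows "(\<lambda>\<omega>. extragradient F \<gamma> p0 (\<lambda>j h. N j h \<omega>) k) \<in> borel_measurable M"
  using assms(2)
proof (induction k)
  case (Suc k)
  have [measurable]: "(\<lambda>\<omega>. extragradient F \<gamma> p0 (\<lambda>j h. N j h \<omega>) k) \<in> borel_measurable M"
    "N k h \<in> borel_measurable M" for h
    using Suc by auto
  show ?case by (simp add: Let_def)
qed simp

lemma (in finite_measure) extragradient_square_integrable:
  fixes F :: "'b::euclidean_space \<Rightarrow> 'b"
  assumes F: "L-lipschitz_on UNIV F"
    and "\<And>j h. j < k \<Longrightarrow> square_integrable M (N j h)"
  shows "square_integrable M (\<lambda>\<omega>. extragradient F \<gamma> p0 (\<lambda>j h. N j h \<omega>) k)"
  using assms(2)
proof (induction k)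
  case (Suc k)
  then have "square_integrable M (\<lambda>\<omega>. extragradient F \<gamma> p0 (\<lambda>j h. N j h \<omega>) k)"
    "square_integrable M (N k h)" for h by auto
  then show ?case
    unfolding extragradient.simps Let_def
    by (intro square_integrable_diff square_integrable_scaleR square_integrable_add
        square_integrable_lipschitz[OF F])
qed (simp add: square_integrable_const)

lemma (in finite_measure) extragradient_half_square_integrable:
  fixes F :: "'b::euclidean_space \<Rightarrow> 'b"
  assumes F: "L-lipschitz_on UNIV F"
    and N: "\<And>j h. j \<le> k \<Longrightarrow> square_integrable M (N j h)"
  shows "square_integrable M (\<lambda>\<omega>. extragradient_half F \<gamma> p0 (\<lambda>j h. N j h \<omega>) k)"
proof -
  have "square_integrable M (\<lambda>\<omega>. extragradient F \<gamma> p0 (\<lambda>j h. N j h \<omega>) k)"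
    using F N by (intro extragradient_square_integrable) auto
  then show ?thesis
    unfolding extragradient_half_def Let_def
    by (intro square_integrable_diff square_integrable_scaleR square_integrable_add
        square_integrable_lipschitz[OF F] N order_refl)
qed

lemma (in prob_space) expectation_noise_inner_half_eq_0:
  fixes F :: "'b::euclidean_space \<Rightarrow> 'b"
  assumes F: "L-lipschitz_on UNIV F"
    and ind: "indep_vars (\<lambda>_. borel) (\<lambda>(k, h). N k h) ({..<K} \<times> UNIV)"
    and N: "\<And>k h. k < K \<Longrightarrow> square_integrable M (N k h)"
    and zero: "\<And>k h. k < K \<Longrightarrow> expectation (N k h) = 0"
    and "k < K"
  shows "expectation (\<lambda>\<omega>. N k Half \<omega> \<bullet> (extragradient_half F \<gamma> p0 (\<lambda>j h. N j h \<omega>) k - p0)) = 0"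
proof (rule expectation_inner_indep_eq_0)
  \<comment> \<open>\<open>A\<close> indexes exactly the noise read by the half iterate of step
    \<open>k\<close>; \<open>B\<close> holds the one noise vector paired with it.\<close>
  define A where "A = insert (k, Full) ({..<k} \<times> UNIV)"
  define B where "B = {(k, Half)}"
  define f where "f e = extragradient_half F \<gamma> p0 (\<lambda>j h. e (j, h)) k - p0" for e
  have [measurable]: "F \<in> borel_measurable borel"
    using lipschitz_on_continuous_on[OF F] by (rule borel_measurable_continuous_onI)
  have [measurable]: "(\<lambda>e. extragradient F \<gamma> p0 (\<lambda>j h. e (j, h)) k) \<in> borel_measurable (PiM A (\<lambda>_. borel))"
    by (intro extragradient_measurable[where N = "\<lambda>j h e. e (j, h)"])
      (auto simp: A_def intro!: measurable_component_singleton)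
  have [measurable]: "(\<lambda>e. e (k, Full)) \<in> borel_measurable (PiM A (\<lambda>_. borel))"
    by (intro measurable_component_singleton) (simp add: A_def)
  have f: "f \<in> borel_measurable (PiM A (\<lambda>_. borel))"
    unfolding f_def extragradient_half_def Let_def by measurable
  have g: "(\<lambda>e. e (k, Half)) \<in> borel_measurable (PiM B (\<lambda>_. borel))"
    by (intro measurable_component_singleton) (simp add: B_def)
  have "indep_var (PiM B (\<lambda>_. borel)) (\<lambda>\<omega>. restrict (\<lambda>i. (case i of (k, h) \<Rightarrow> N k h) \<omega>) B)
      (PiM A (\<lambda>_. borel)) (\<lambda>\<omega>. restrict (\<lambda>i. (case i of (k, h) \<Rightarrow> N k h) \<omega>) A)"
    by (rule indep_var_restrict[OF ind]) (use \<open>k < K\<close> in \<open>auto simp: A_def B_def\<close>)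
  from indep_var_compose[OF this g f]
  have "indep_var borel (\<lambda>\<omega>. N k Half \<omega>)
      borel (\<lambda>\<omega>. f (restrict (\<lambda>i. (case i of (k, h) \<Rightarrow> N k h) \<omega>) A))"
    by (simp add: o_def B_def)
  \<comment> \<open>Restriction to \<open>A\<close> makes the other entries
    \<open>undefined\<close>, but \<open>f\<close> never reads them.\<close>
  moreover have "f (restrict (\<lambda>i. (case i of (k, h) \<Rightarrow> N k h) \<omega>) A) =
      extragradient_half F \<gamma> p0 (\<lambda>j h. N j h \<omega>) k - p0" for \<omega>
    unfolding f_def by (intro arg_cong2[where f = minus] extragradient_half_cong) (auto simp: A_def)
  ultimately show "indep_var borel (N k Half)
      borel (\<lambda>\<omega>. extragradient_half F \<gamma> p0 (\<lambda>j h. N j h \<omega>) k - p0)"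
    by simp
  show "square_integrable M (\<lambda>\<omega>. extragradient_half F \<gamma> p0 (\<lambda>j h. N j h \<omega>) k - p0)"
    using N \<open>k < K\<close>
    by (intro square_integrable_diff square_integrable_const
        extragradient_half_square_integrable[OF F]) auto
qed (use \<open>k < K\<close> N zero in auto)

text \<open>The constant is \<open>17 = 8 * 2 + 1\<close>: two noises per iteration in
  \<open>S\<close>, plus \<open>U\<close>, whose expectation is at most \<open>K v\<close> by
  independence. The correlation term \<open>C\<close> has mean zero.\<close>

lemma (in prob_space) extragradient_expected_noise:
  fixes F :: "'b::euclidean_space \<Rightarrow> 'b" and p0 :: 'b
  assumes F: "L-lipschitz_on UNIV F" and "0 \<le> \<gamma>"
    and ind: "indep_vars (\<lambda>_. borel) (\<lambda>(k, h). N k h) ({..<K} \<times> UNIV)"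
    and N: "\<And>k h. k < K \<Longrightarrow> square_integrable M (N k h)"
    and zero: "\<And>k h. k < K \<Longrightarrow> expectation (N k h) = 0"
    and v: "\<And>k h. k < K \<Longrightarrow> expectation (\<lambda>\<omega>. (norm (N k h \<omega>))\<^sup>2) \<le> v"
  defines "R \<equiv> \<lambda>\<omega>. 8 * \<gamma> * (\<Sum>k<K. (norm (N k Half \<omega>))\<^sup>2 + (norm (N k Full \<omega>))\<^sup>2) +
     \<gamma> * (norm (\<Sum>k<K. N k Half \<omega>))\<^sup>2 -
     (\<Sum>k<K. N k Half \<omega> \<bullet> (extragradient_half F \<gamma> p0 (\<lambda>j h. N j h \<omega>) k - p0))"
  shows "integrable M R" and "expectation R \<le> 17 * \<gamma> * real K * v"
proof -
  have i1: "integrable M (\<lambda>\<omega>. (norm (N k h \<omega>))\<^sup>2)" if "k < K" for k h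
    using N[OF that] by (simp add: square_integrable_def)
  have i2: "integrable M (\<lambda>\<omega>. (norm (\<Sum>k<K. N k Half \<omega>))\<^sup>2)"
    using square_integrable_sum[of "{..<K}" "\<lambda>k. N k Half"] N by (simp add: square_integrable_def)
  have i3: "integrable M (\<lambda>\<omega>. N k Half \<omega> \<bullet> (extragradient_half F \<gamma> p0 (\<lambda>j h. N j h \<omega>) k - p0))"
    if "k < K" for k
    using N that
    by (intro square_integrable_inner square_integrable_diff square_integrable_const
        extragradient_half_square_integrable[OF F]) auto
  define S where "S \<omega> = (\<Sum>k<K. (norm (N k Half \<omega>))\<^sup>2 + (norm (N k Full \<omega>))\<^sup>2)" for \<omega>
  define U where "U \<omega> = (norm (\<Sum>k<K. N k Half \<omega>))\<^sup>2" for \<omega>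
  define C where "C \<omega> = (\<Sum>k<K. N k Half \<omega> \<bullet>
    (extragradient_half F \<gamma> p0 (\<lambda>j h. N j h \<omega>) k - p0))" for \<omega>
  have R: "R = (\<lambda>\<omega>. 8 * \<gamma> * S \<omega> + \<gamma> * U \<omega> - C \<omega>)"
    by (simp add: R_def S_def U_def C_def)
  have iS: "integrable M S" unfolding S_def
    by (intro Bochner_Integration.integrable_sum Bochner_Integration.integrable_add i1) auto
  have iU: "integrable M U" unfolding U_def by (rule i2)
  have iC: "integrable M C" unfolding C_def
    by (intro Bochner_Integration.integrable_sum i3) auto
  show "integrable M R"
    unfolding R using iS iU iC by simp
  have eS: "expectation S \<le> real K * (v + v)"
  proof -
    have "expectation S = (\<Sum>k<K. expectation (\<lambda>\<omega>. (norm (N k Half \<omega>))\<^sup>2 + (norm (N k Full \<omega>))\<^sup>2))"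
      unfolding S_def
      by (intro Bochner_Integration.integral_sum Bochner_Integration.integrable_add i1) auto
    also have "\<dots> \<le> (\<Sum>k<K. v + v)"
    proof (rule sum_mono)
      fix k assume "k \<in> {..<K}"
      then have "k < K" by simp
      then show "expectation (\<lambda>\<omega>. (norm (N k Half \<omega>))\<^sup>2 + (norm (N k Full \<omega>))\<^sup>2) \<le> v + v"
        using add_mono[OF v[of k Half] v[of k Full]] by (simp add: i1)
    qed
    finally show ?thesis by simp
  qed
  have eC: "expectation C = 0"
  proof -
    have "expectation C = (\<Sum>k<K. expectation (\<lambda>\<omega>. N k Half \<omega> \<bullet>
        (extragradient_half F \<gamma> p0 (\<lambda>j h. N j h \<omega>) k - p0)))"
      unfolding C_def by (intro Bochner_Integration.integral_sum i3) simp
    also have "\<dots> = 0"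
      by (intro sum.neutral ballI expectation_noise_inner_half_eq_0[OF F ind N zero]) auto
    finally show ?thesis .
  qed
  have inj: "inj_on (\<lambda>k. (k, Half)) {..<K}" by (auto intro: inj_onI)
  have "indep_vars (\<lambda>_. borel) (\<lambda>(k, h). N k h) ((\<lambda>k. (k, Half)) ` {..<K})"
    by (rule indep_vars_subset[OF ind]) auto
  from expectation_norm_sum_indep[OF this] N zero
  have "expectation (\<lambda>\<omega>. (norm (\<Sum>k<K. N k Half \<omega>))\<^sup>2) =
      (\<Sum>k<K. expectation (\<lambda>\<omega>. (norm (N k Half \<omega>))\<^sup>2))"
    by (auto simp: sum.reindex[OF inj])
  also have "\<dots> \<le> real K * v"
    using sum_bounded_above[of "{..<K}" "\<lambda>k. expectation (\<lambda>\<omega>. (norm (N k Half \<omega>))\<^sup>2)" v] v by simp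
  finally have eU: "expectation U \<le> real K * v" unfolding U_def .
  have "expectation R = 8 * \<gamma> * expectation S + \<gamma> * expectation U - expectation C"
    unfolding R using iS iU iC by simp
  also have "\<dots> \<le> 8 * \<gamma> * (real K * (v + v)) + \<gamma> * (real K * v)"
    unfolding eC diff_0_right using \<open>0 \<le> \<gamma>\<close> by (intro add_mono mult_left_mono eS eU) auto
  finally show "expectation R \<le> 17 * \<gamma> * real K * v" by (simp add: algebra_simps)
qed

section \<open>The operator of the saddle point problem\<close>

lemma subspace_block_space: "subspace (block_space blk i)"
  by (auto simp: subspace_def block_space_def)

lemma block_mem_block_space: "block blk i x \<in> block_space blk i"
  by (simp add: block_def block_space_def)

lemma linear_block: "linear (block blk i)"
  by (rule linearI) (auto simp: block_def vec_eq_iff)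

lemma sum_block: "(\<Sum>i\<in>UNIV. block (blk :: 'd::finite \<Rightarrow> 'n::finite) i x) = x"
  by (simp add: block_def vec_eq_iff)

lemma inner_block_space:
  assumes "g \<in> block_space blk i"
  shows "g \<bullet> block blk i x = g \<bullet> x"
  unfolding inner_vec_def by (rule sum.cong) (use assms in \<open>auto simp: block_def block_space_def\<close>)

text \<open>Distinct blocks have disjoint supports, so Pythagoras applies.\<close>

lemma norm_sum_block_space:
  fixes blk :: "'d::finite \<Rightarrow> 'n::finite"
  assumes "\<And>i. g i \<in> block_space blk i"
  shows "(norm (\<Sum>i\<in>UNIV. g i))\<^sup>2 = (\<Sum>i\<in>UNIV. (norm (g i))\<^sup>2)"
proof (rule norm_sum_Pythagorean)
  show "pairwise (\<lambda>i j. orthogonal (g i) (g j)) UNIV"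
    unfolding pairwise_def orthogonal_def inner_vec_def
  proof (intro ballI impI sum.neutral)
    fix i j :: 'n and k assume "i \<noteq> j"
    then show "g i $ k \<bullet> g j $ k = 0"
      using assms[of i] assms[of j] by (cases "blk k = i") (simp_all add: block_space_def)
  qed
qed simp

lemma sum_block_matrix_mult:
  fixes blk :: "'d::finite \<Rightarrow> 'n::finite"
  shows "(\<Sum>i\<in>UNIV. block_matrix blk A i *v block blk i x) = A *v x"
proof -
  have "block_matrix blk A i *v block blk i x = A *v block blk i x" for i
    by (auto simp: vec_eq_iff matrix_vector_mult_def block_matrix_def block_def intro!: sum.cong)
  then show ?thesis
    by (simp add: linear_sum[OF matrix_vector_mul_linear, symmetric] sum_block)
qed

lemma sum_transpose_block_matrix_mult:
  fixes blk :: "'d::finite \<Rightarrow> 'n::finite"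
  shows "(\<Sum>i\<in>UNIV. transpose (block_matrix blk A i) *v w) = transpose A *v w"
proof -
  have "transpose (block_matrix blk A i) *v w = block blk i (transpose A *v w)" for i
    by (auto simp: vec_eq_iff matrix_vector_mult_def transpose_def block_matrix_def block_def)
  then show ?thesis by (simp add: sum_block)
qed

text \<open>The gradient of the sum of the \<open>r i\<close> over the blocks of \<open>x\<close>,
  assembled from block gradients that already live in the full space.\<close>

definition separable_gradient ::
  "('d::finite \<Rightarrow> 'n::finite) \<Rightarrow> ('n \<Rightarrow> real^'d \<Rightarrow> real) \<Rightarrow> real^'d \<Rightarrow> real^'d" where
  "separable_gradient blk r x =
     (\<Sum>i\<in>UNIV. gradient_on (block_space blk i) (r i) (block blk i x))"

lemma separable_gradient_le:
  fixes blk :: "'d::finite \<Rightarrow> 'n::finite"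
  assumes r: "\<And>i. L_smooth_on (block_space blk i) L (r i)"
    and conv: "\<And>i. convex_on (block_space blk i) (r i)"
  shows "(\<Sum>i\<in>UNIV. r i (block blk i u)) + separable_gradient blk r u \<bullet> (v - u) \<le>
    (\<Sum>i\<in>UNIV. r i (block blk i v))"
  unfolding separable_gradient_def inner_sum_left sum.distrib[symmetric]
proof (rule sum_mono)
  fix i
  let ?g = "gradient_on (block_space blk i) (r i) (block blk i u)"
  have diff: "r i differentiable_on block_space blk i" using r by (simp add: L_smooth_on_def)
  have "?g \<bullet> (v - u) = ?g \<bullet> block blk i (v - u)"
    by (rule inner_block_space[symmetric])
      (rule gradient_on_mem[OF subspace_block_space block_mem_block_space diff])
  also have "\<dots> = ?g \<bullet> (block blk i v - block blk i u)"
    by (simp add: linear_diff[OF linear_block])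
  finally show "r i (block blk i u) + ?g \<bullet> (v - u) \<le> r i (block blk i v)"
    using convex_on_gradient_on_le[OF subspace_block_space block_mem_block_space
        block_mem_block_space diff conv] by metis
qed

text \<open>Squared norms add over orthogonal blocks, so the constant \<open>L\<close> does not grow
  with the number of blocks.\<close>

lemma separable_gradient_lipschitz:
  fixes blk :: "'d::finite \<Rightarrow> 'n::finite"
  assumes r: "\<And>i. L_smooth_on (block_space blk i) L (r i)"
  shows "norm (separable_gradient blk r u - separable_gradient blk r v) \<le> L * norm (u - v)"
proof (rule power2_le_imp_le)
  let ?g = "\<lambda>i u. gradient_on (block_space blk i) (r i) (block blk i u)"
  have mem: "?g i u \<in> block_space blk i" for i u
    using r by (intro gradient_on_mem subspace_block_space block_mem_block_space)
      (simp add: L_smooth_on_def)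
  have "(norm (separable_gradient blk r u - separable_gradient blk r v))\<^sup>2 =
      (norm (\<Sum>i\<in>UNIV. ?g i u - ?g i v))\<^sup>2"
    by (simp add: separable_gradient_def sum_subtractf)
  also have "\<dots> = (\<Sum>i\<in>UNIV. (norm (?g i u - ?g i v))\<^sup>2)"
    by (rule norm_sum_block_space) (rule subspace_diff[OF subspace_block_space mem mem])
  also have "\<dots> \<le> (\<Sum>i\<in>UNIV. L\<^sup>2 * (norm (block blk i (u - v)))\<^sup>2)"
  proof (rule sum_mono)
    fix i
    have "norm (?g i u - ?g i v) \<le> L * norm (block blk i (u - v))"
      using r[of i] block_mem_block_space[of blk i]
      by (simp add: L_smooth_on_def linear_diff[OF linear_block])
    then show "(norm (?g i u - ?g i v))\<^sup>2 \<le> L\<^sup>2 * (norm (block blk i (u - v)))\<^sup>2"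
      unfolding power_mult_distrib[symmetric] by (rule power_mono) simp
  qed
  also have "\<dots> = (L * norm (u - v))\<^sup>2"
    unfolding sum_distrib_left[symmetric] norm_sum_block_space[OF block_mem_block_space, symmetric]
      sum_block power_mult_distrib ..
  finally show "(norm (separable_gradient blk r u - separable_gradient blk r v))\<^sup>2 \<le>
    (L * norm (u - v))\<^sup>2" .
  show "0 \<le> L * norm (u - v)" using r by (simp add: L_smooth_on_def less_imp_le)
qed

lemma continuous_on_separable:
  fixes blk :: "'d::finite \<Rightarrow> 'n::finite"
  assumes "\<And>i. L_smooth_on (block_space blk i) L (r i)"
  shows "continuous_on UNIV (\<lambda>x. \<Sum>i\<in>UNIV. r i (block blk i x))"
proof (intro continuous_on_sum)
  fix i
  show "continuous_on UNIV (\<lambda>x. r i (block blk i x))"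
  proof (rule continuous_on_compose2[where g = "r i" and f = "block blk i"])
    show "continuous_on (block_space blk i) (r i)"
      using assms by (intro differentiable_imp_continuous_on) (simp add: L_smooth_on_def)
    show "continuous_on UNIV (block blk i)"
      by (rule linear_continuous_on) (simp add: linear_block linear_conv_bounded_linear[symmetric])
  qed (auto simp: block_mem_block_space)
qed

section \<open>The saddle operator, its noise and its contraction property\<close>

text \<open>The gradient field in the minimised variables and the negated one in \<open>y\<close>;
  the sign makes the coupling part skew.\<close>

definition saddle_operator ::
  "real^'d^'s \<Rightarrow> (real^'d \<Rightarrow> real^'d) \<Rightarrow> (real^'s \<Rightarrow> real^'s) \<Rightarrow> ('d, 's) point \<Rightarrow> ('d, 's) point"
  where "saddle_operator A gf gh = (\<lambda>(x, z, y). (transpose A *v y + gf x, gh z - y, z - A *v x))"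

definition lagrangian_operator ::
  "('d::finite \<Rightarrow> 'n::finite) \<Rightarrow> real^'d^'s \<Rightarrow> real^'s \<Rightarrow> (real^'s \<Rightarrow> real^'s \<Rightarrow> real) \<Rightarrow>
   ('n \<Rightarrow> real^'d \<Rightarrow> real) \<Rightarrow> ('d, 's) point \<Rightarrow> ('d, 's) point" where
  "lagrangian_operator blk A b ell r =
     saddle_operator A (separable_gradient blk r) (gradient_on UNIV (\<lambda>t. ell t b))"

text \<open>The minus sign matches the negated third component of the operator, and the zero
  reflects that \<open>z\<close> is updated without communication.\<close>

definition transmission_noise ::
  "real^'d^'s \<Rightarrow> ('n::finite noise_role \<Rightarrow> real^'s) \<Rightarrow> ('d, 's) point" where
  "transmission_noise A e = (transpose A *v e Dual, 0, - (\<Sum>i\<in>UNIV. e (Device i)))"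

text \<open>By linearity, noise added before multiplication by the transposed blocks comes out as an
  additive perturbation of the operator.\<close>

lemma update_eq_operator_step:
  "update blk A b ell r \<gamma> p q e = p - \<gamma> *\<^sub>R
     (lagrangian_operator blk A b ell r q +
      transmission_noise A e)"
proof -
  obtain x z y where p: "p = (x, z, y)" by (cases p)
  obtain u v w where q: "q = (u, v, w)" by (cases q)
  have "(\<Sum>i\<in>UNIV. block blk i x - \<gamma> *\<^sub>R (transpose (block_matrix blk A i) *v (w + e Dual) +
      gradient_on (block_space blk i) (r i) (block blk i u))) =
      x - \<gamma> *\<^sub>R (transpose A *v (w + e Dual) + separable_gradient blk r u)"
    by (simp only: sum_subtractf sum_block scaleR_sum_right[symmetric] sum.distrib
        sum_transpose_block_matrix_mult separable_gradient_def)
  moreover have "(\<Sum>i\<in>UNIV. block_matrix blk A i *v block blk i u + e (Device i)) - v =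
      A *v u + (\<Sum>i\<in>UNIV. e (Device i)) - v"
    by (simp add: sum.distrib sum_block_matrix_mult)
  ultimately show ?thesis
    by (simp add: p q update_def lagrangian_operator_def saddle_operator_def transmission_noise_def
        matrix_vector_right_distrib algebra_simps)
qed

lemma iterate_eq_extragradient:
  fixes blk :: "'d::finite \<Rightarrow> 'n::finite"
  shows "iterate blk A b ell r \<gamma> p0 e k =
    extragradient (lagrangian_operator blk A b ell r) \<gamma> p0 (\<lambda>k h. transmission_noise A (e k h)) k"
  by (induction k) (simp_all add: Let_def update_eq_operator_step)

lemma half_iterate_eq_extragradient_half:
  fixes blk :: "'d::finite \<Rightarrow> 'n::finite"
  shows "half_iterate blk A b ell r \<gamma> p0 e k =
    extragradient_half (lagrangian_operator blk A b ell r) \<gamma> p0 (\<lambda>k h. transmission_noise A (e k h)) k"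
  by (simp add: half_iterate_def extragradient_half_def Let_def update_eq_operator_step
      iterate_eq_extragradient)

text \<open>
  The three squares are the squared norms of the components of \<open>\<gamma> (F p - F q)\<close>. Their quadratic form
  has largest eigenvalue about 0.831, so the factor \<open>7 / 8\<close> is available although a plain
  Young inequality on each component gives only the factor 1.
\<close>

lemma coupling_quadratic_form_le:
  fixes a c d \<beta> :: real
  assumes "8 * \<beta>\<^sup>2 \<le> 1"
  shows "(\<beta> * c + a / 2)\<^sup>2 + (d / 2 + c / 2)\<^sup>2 + (d / 2 + \<beta> * a)\<^sup>2 \<le> 7 / 8 * (a\<^sup>2 + (d\<^sup>2 + c\<^sup>2))"
proof -
  have eqs: "(\<beta> * c + a / 2)\<^sup>2 = \<beta>\<^sup>2 * c\<^sup>2 + \<beta> * (a * c) + a\<^sup>2 / 4"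
    "(d / 2 + c / 2)\<^sup>2 = d\<^sup>2 / 4 + c * d / 2 + c\<^sup>2 / 4"
    "(d / 2 + \<beta> * a)\<^sup>2 = d\<^sup>2 / 4 + \<beta> * (a * d) + \<beta>\<^sup>2 * a\<^sup>2"
    by (simp_all add: power2_eq_square field_simps)
  \<comment> \<open>One square for each cross term, split so that \<open>a\<^sup>2\<close> and
    \<open>d\<^sup>2\<close> receive exactly \<open>3/4 + 1/8\<close> and \<open>c\<^sup>2\<close>
    only \<open>3/4\<close>.\<close>
  have "0 \<le> a\<^sup>2 / 4 - \<beta> * (a * c) + \<beta>\<^sup>2 * c\<^sup>2" "0 \<le> a\<^sup>2 / 4 - \<beta> * (a * d) + \<beta>\<^sup>2 * d\<^sup>2"
      "0 \<le> d\<^sup>2 / 4 - c * d / 2 + c\<^sup>2 / 4"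
    using zero_le_power2[of "a / 2 - \<beta> * c"] zero_le_power2[of "a / 2 - \<beta> * d"]
      zero_le_power2[of "d / 2 - c / 2"]
    by (simp_all add: power2_eq_square field_simps)
  moreover have "\<beta>\<^sup>2 * a\<^sup>2 \<le> a\<^sup>2 / 8" "\<beta>\<^sup>2 * c\<^sup>2 \<le> c\<^sup>2 / 8" "\<beta>\<^sup>2 * d\<^sup>2 \<le> d\<^sup>2 / 8"
    using mult_right_mono[OF assms, of "a\<^sup>2"] mult_right_mono[OF assms, of "c\<^sup>2"]
      mult_right_mono[OF assms, of "d\<^sup>2"] by simp_all
  moreover have "0 \<le> c\<^sup>2" by simp
  ultimately show ?thesis unfolding eqs distrib_left by linarith
qed

text \<open>The triangle inequality bounds each component by a linear form in \<open>a\<close>,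
  \<open>d\<close>, \<open>c\<close>. The three squares are then estimated jointly by
  \<open>coupling_quadratic_form_le\<close>, with \<open>\<beta>\<^sup>2 \<le> 1/8\<close> from the
  last stepsize condition.\<close>

lemma saddle_operator_contraction:
  assumes gf: "\<And>u v. norm (gf u - gf v) \<le> Lr * norm (u - v)"
    and gh: "\<And>u v. norm (gh u - gh v) \<le> Ll * norm (u - v)"
    and \<gamma>: "0 \<le> \<gamma>" "\<gamma> \<le> 1 / 2" "\<gamma> * Lr \<le> 1 / 2" "\<gamma> * Ll \<le> 1 / 2"
      "8 * (\<gamma>\<^sup>2 * lambda_max (transpose A ** A)) \<le> 1"
  shows "\<gamma>\<^sup>2 * (norm (saddle_operator A gf gh p - saddle_operator A gf gh q))\<^sup>2 \<le>
    7 / 8 * (norm (p - q))\<^sup>2"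
proof -
  obtain x z y where p: "p = (x, z, y)" by (cases p)
  obtain u v w where q: "q = (u, v, w)" by (cases q)
  define l where "l = sqrt (lambda_max (transpose A ** A))"
  define \<beta> where "\<beta> = \<gamma> * l"
  have l0: "0 \<le> l" by (simp add: l_def lambda_max_gram_nonneg)
  have A: "norm (A *v t) \<le> l * norm t" for t
    using real_sqrt_le_mono[OF norm_matrix_vector_le_lambda_max[of A t]]
    by (simp add: l_def real_sqrt_mult)
  have At: "norm (transpose A *v t) \<le> l * norm t" for t
    by (rule norm_transpose_matrix_vector_le[OF l0 A])
  define a d c where "a = norm (x - u)" and "d = norm (z - v)" and "c = norm (y - w)"
  have 1: "\<gamma> * norm (transpose A *v (y - w) + (gf x - gf u)) \<le> \<beta> * c + a / 2"
  proof -
    have "\<gamma> * norm (transpose A *v (y - w) + (gf x - gf u)) \<le> \<gamma> * (l * c + Lr * a)"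
      using At[of "y - w"] gf[of x u] norm_triangle_ineq[of "transpose A *v (y - w)" "gf x - gf u"] \<gamma>(1)
      by (intro mult_left_mono) (auto simp: a_def c_def)
    also have "\<dots> \<le> \<beta> * c + a / 2"
      using mult_right_mono[OF \<gamma>(3), of a] by (simp add: \<beta>_def a_def algebra_simps)
    finally show ?thesis .
  qed
  have 2: "\<gamma> * norm ((gh z - gh v) - (y - w)) \<le> d / 2 + c / 2"
  proof -
    have "\<gamma> * norm ((gh z - gh v) - (y - w)) \<le> \<gamma> * (Ll * d + c)"
      using gh[of z v] norm_triangle_ineq4[of "gh z - gh v" "y - w"] \<gamma>(1)
      by (intro mult_left_mono) (auto simp: d_def c_def)
    also have "\<dots> \<le> d / 2 + c / 2"
      using mult_right_mono[OF \<gamma>(4), of d] mult_right_mono[OF \<gamma>(2), of c]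
      by (simp add: d_def c_def algebra_simps)
    finally show ?thesis .
  qed
  have 3: "\<gamma> * norm ((z - v) - A *v (x - u)) \<le> d / 2 + \<beta> * a"
  proof -
    have "\<gamma> * norm ((z - v) - A *v (x - u)) \<le> \<gamma> * (d + l * a)"
      using A[of "x - u"] norm_triangle_ineq4[of "z - v" "A *v (x - u)"] \<gamma>(1)
      by (intro mult_left_mono) (auto simp: d_def a_def)
    also have "\<dots> \<le> d / 2 + \<beta> * a"
      using mult_right_mono[OF \<gamma>(2), of d]
      by (simp add: d_def \<beta>_def algebra_simps)
    finally show ?thesis .
  qed
  have sq: "\<gamma>\<^sup>2 * (norm t)\<^sup>2 \<le> s\<^sup>2" if "\<gamma> * norm t \<le> s" for t :: "'z::real_normed_vector" and s
    unfolding power_mult_distrib[symmetric] using that \<gamma>(1) by (intro power_mono) auto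
  have "saddle_operator A gf gh p - saddle_operator A gf gh q =
      (transpose A *v (y - w) + (gf x - gf u), (gh z - gh v) - (y - w), (z - v) - A *v (x - u))"
    by (simp add: p q saddle_operator_def matrix_vector_mult_diff_distrib algebra_simps)
  then have "\<gamma>\<^sup>2 * (norm (saddle_operator A gf gh p - saddle_operator A gf gh q))\<^sup>2 =
      \<gamma>\<^sup>2 * (norm (transpose A *v (y - w) + (gf x - gf u)))\<^sup>2 +
      (\<gamma>\<^sup>2 * (norm ((gh z - gh v) - (y - w)))\<^sup>2 + \<gamma>\<^sup>2 * (norm ((z - v) - A *v (x - u)))\<^sup>2)"
    by (simp add: norm_prod_def distrib_left)
  also have "\<dots> \<le> (\<beta> * c + a / 2)\<^sup>2 + ((d / 2 + c / 2)\<^sup>2 + (d / 2 + \<beta> * a)\<^sup>2)"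
    by (intro add_mono sq 1 2 3)
  also have "\<dots> \<le> 7 / 8 * (a\<^sup>2 + (d\<^sup>2 + c\<^sup>2))"
    using coupling_quadratic_form_le[of \<beta> c a d] \<gamma>(5)
    by (simp add: \<beta>_def l_def power_mult_distrib lambda_max_gram_nonneg)
  also have "\<dots> = 7 / 8 * (norm (p - q))\<^sup>2"
    by (simp add: p q norm_prod_def a_def d_def c_def)
  finally show ?thesis .
qed

lemma lagrangian_eq:
  "lagrangian blk A b ell r x z y =
    ell z b + (\<Sum>i\<in>UNIV. r i (block blk i x)) + y \<bullet> (A *v x - z)"
  by (simp add: lagrangian_def sum_block_matrix_mult)

text \<open>The bilinear coupling contributes an exact identity to the gap estimate; inequalities
  come only from the convex terms.\<close>

lemma inner_skew_coupling:
  fixes A :: "real^'d^'s"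
  shows "v \<bullet> (A *v x - z) - y \<bullet> (A *v u - w) =
    (transpose A *v y) \<bullet> (x - u) - y \<bullet> (z - w) + (z - A *v x) \<bullet> (y - v)"
  unfolding inner_transpose_matrix_vector
  by (simp add: matrix_vector_mult_diff_distrib inner_diff inner_commute)

text \<open>Jensen's inequality from one subgradient at the mean: the linear terms sum to
  zero.\<close>

lemma mean_le_of_subgradient:
  fixes q :: "nat \<Rightarrow> 'a::real_inner"
  assumes "0 < K" and a: "a = (1 / real K) *\<^sub>R (\<Sum>k<K. q k)"
    and g: "\<And>v. f a + g \<bullet> (v - a) \<le> f v"
  shows "real K * f a \<le> (\<Sum>k<K. f (q k))"
proof -
  have "real K *\<^sub>R a = (\<Sum>k<K. q k)" using \<open>0 < K\<close> by (simp add: a)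
  then have "(\<Sum>k<K. f a + g \<bullet> (q k - a)) = real K * f a"
    by (simp add: sum.distrib inner_sum_right[symmetric] sum_subtractf scaleR_conv_of_real sum_constant_scaleR)
  moreover have "(\<Sum>k<K. f a + g \<bullet> (q k - a)) \<le> (\<Sum>k<K. f (q k))" by (rule sum_mono) (rule g)
  ultimately show ?thesis by simp
qed

section \<open>The gap\<close>

text \<open>All the affine functions share the Lipschitz constant \<open>C\<close>, which survives
  the supremum.\<close>

lemma continuous_on_SUP_affine:
  fixes J :: "'i \<Rightarrow> 'a::real_inner" and c :: "'i \<Rightarrow> real"
  assumes "S \<noteq> {}" and c: "bdd_above (c ` S)" and J: "bounded (J ` S)"
  shows "continuous_on UNIV (\<lambda>p. SUP u\<in>S. c u + p \<bullet> J u)"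
proof -
  obtain C where C: "\<And>u. u \<in> S \<Longrightarrow> norm (J u) \<le> C" and "0 < C"
    using J unfolding bounded_pos by auto
  obtain m where m: "\<And>u. u \<in> S \<Longrightarrow> c u \<le> m" using c by (auto simp: bdd_above_def)
  have inner: "p \<bullet> J u \<le> C * norm p" if "u \<in> S" for p u
    using norm_cauchy_schwarz[of p "J u"] mult_left_mono[OF C[OF that] norm_ge_zero[of p]]
    by (simp add: mult.commute)
  have bdd: "bdd_above ((\<lambda>u. c u + p \<bullet> J u) ` S)" for p
    by (rule bdd_aboveI2[where M = "m + C * norm p"]) (intro add_mono m inner)
  have le: "(SUP u\<in>S. c u + p \<bullet> J u) \<le> (SUP u\<in>S. c u + q \<bullet> J u) + C * norm (p - q)" for p q
  proof (rule cSUP_least[OF \<open>S \<noteq> {}\<close>])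
    fix u assume u: "u \<in> S"
    have "c u + p \<bullet> J u = c u + q \<bullet> J u + (p - q) \<bullet> J u" by (simp add: inner_diff_left)
    also have "\<dots> \<le> (SUP u\<in>S. c u + q \<bullet> J u) + C * norm (p - q)"
      by (intro add_mono cSUP_upper u bdd inner)
    finally show "c u + p \<bullet> J u \<le> (SUP u\<in>S. c u + q \<bullet> J u) + C * norm (p - q)" .
  qed
  have "C-lipschitz_on UNIV (\<lambda>p. SUP u\<in>S. c u + p \<bullet> J u)"
  proof (rule lipschitz_onI)
    fix p q :: 'a
    show "dist (SUP u\<in>S. c u + p \<bullet> J u) (SUP u\<in>S. c u + q \<bullet> J u) \<le> C * dist p q"
      using le[of p q] le[of q p] by (simp add: dist_norm norm_minus_commute abs_le_iff)
  qed (use \<open>0 < C\<close> in simp)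
  then show ?thesis by (rule lipschitz_on_continuous_on)
qed

lemma lipschitz_on_of_contraction:
  fixes F :: "'a::real_normed_vector \<Rightarrow> 'a"
  assumes "0 < \<gamma>" and F: "\<And>p q. \<gamma>\<^sup>2 * (norm (F p - F q))\<^sup>2 \<le> 7 / 8 * (norm (p - q))\<^sup>2"
  shows "(1 / \<gamma>)-lipschitz_on UNIV F"
proof (rule lipschitz_onI)
  fix p q
  have "(\<gamma> * norm (F p - F q))\<^sup>2 \<le> (norm (p - q))\<^sup>2"
    unfolding power_mult_distrib using F[of p q] zero_le_power2[of "norm (p - q)"] by linarith
  then have "\<gamma> * norm (F p - F q) \<le> norm (p - q)" by (rule power2_le_imp_le) simp
  then show "dist (F p) (F q) \<le> 1 / \<gamma> * dist p q"
    using \<open>0 < \<gamma>\<close> by (simp add: dist_norm field_simps)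
qed (use \<open>0 < \<gamma>\<close> in simp)

locale saddle_problem =
  fixes blk :: "'d::finite \<Rightarrow> 'n::finite" and A :: "real^'d^'s" and b :: "real^'s"
    and ell :: "real^'s \<Rightarrow> real^'s \<Rightarrow> real" and r :: "'n \<Rightarrow> real^'d \<Rightarrow> real"
    and X :: "(real^'d) set" and Z Y :: "(real^'s) set" and Ll Lr :: real
  assumes ell_smooth: "L_smooth_on UNIV Ll (\<lambda>z. ell z b)"
    and ell_convex: "convex_on UNIV (\<lambda>z. ell z b)"
    and r_smooth: "\<And>i. L_smooth_on (block_space blk i) Lr (r i)"
    and r_convex: "\<And>i. convex_on (block_space blk i) (r i)"
    and compact_sets: "compact X" "compact Z" "compact Y"
    and nonempty_sets: "X \<noteq> {}" "Z \<noteq> {}" "Y \<noteq> {}"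
begin

abbreviation objective :: "real^'d \<Rightarrow> real^'s \<Rightarrow> real" where
  "objective x z \<equiv> ell z b + (\<Sum>i\<in>UNIV. r i (block blk i x))"

abbreviation Lag :: "real^'d \<Rightarrow> real^'s \<Rightarrow> real^'s \<Rightarrow> real" where
  "Lag \<equiv> lagrangian blk A b ell r"

abbreviation F :: "('d, 's) point \<Rightarrow> ('d, 's) point" where
  "F \<equiv> lagrangian_operator blk A b ell r"

abbreviation Gap :: "('d, 's) point \<Rightarrow> real" where
  "Gap \<equiv> gap blk A b ell r X Z Y"

lemma continuous_on_objective [continuous_intros]:
  assumes f: "continuous_on S f" and g: "continuous_on S g"
  shows "continuous_on S (\<lambda>t. objective (f t) (g t))"
proof (rule continuous_on_add)
  have "(\<lambda>z. ell z b) differentiable_on UNIV" using ell_smooth by (simp add: L_smooth_on_def)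
  then have "continuous_on UNIV (\<lambda>z. ell z b)" by (rule differentiable_imp_continuous_on)
  then show "continuous_on S (\<lambda>t. ell (g t) b)" by (rule continuous_on_compose2[OF _ g]) simp
  have "continuous_on UNIV (\<lambda>x. \<Sum>i\<in>UNIV. r i (block blk i x))"
    by (rule continuous_on_separable) (rule r_smooth)
  then show "continuous_on S (\<lambda>t. \<Sum>i\<in>UNIV. r i (block blk i (f t)))"
    by (rule continuous_on_compose2[OF _ f]) simp
qed

lemma continuous_on_Lag [continuous_intros]:
  assumes "continuous_on S f" "continuous_on S g" "continuous_on S h"
  shows "continuous_on S (\<lambda>t. Lag (f t) (g t) (h t))"
  unfolding lagrangian_eq using assms
  by (intro continuous_intros bounded_linear.continuous_on[OF matrix_vector_mul_bounded_linear]
      continuous_on_objective[of S f g, simplified]) auto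

text \<open>Continuity on compact sets bounds the two families, which is what makes the real
  \<open>SUP\<close> and \<open>INF\<close> genuine bounds.\<close>

lemma Lag_diff_le_Gap:
  assumes "u \<in> X" "w \<in> Z" "v \<in> Y"
  shows "Lag x z v - Lag u w y \<le> Gap (x, z, y)"
proof -
  have "compact ((\<lambda>v. Lag x z v) ` Y)"
    by (intro compact_continuous_image continuous_intros compact_sets)
  then have "Lag x z v \<le> (SUP y'\<in>Y. Lag x z y')"
    using assms by (intro cSUP_upper bounded_imp_bdd_above compact_imp_bounded)
  moreover have "compact ((\<lambda>t. Lag (fst t) (snd t) y) ` (X \<times> Z))"
    by (intro compact_continuous_image continuous_intros compact_Times compact_sets)
  then have "(INF t\<in>X \<times> Z. Lag (fst t) (snd t) y) \<le> Lag (fst (u, w)) (snd (u, w)) y"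
    using assms by (intro cINF_lower bounded_imp_bdd_below compact_imp_bounded) auto
  ultimately show ?thesis by (simp add: gap_def case_prod_beta')
qed

lemma Gap_le:
  assumes "\<And>u w v. u \<in> X \<Longrightarrow> w \<in> Z \<Longrightarrow> v \<in> Y \<Longrightarrow> Lag x z v - Lag u w y \<le> B"
  shows "Gap (x, z, y) \<le> B"
proof -
  have "(SUP v\<in>Y. Lag x z v) \<le> (INF t\<in>X \<times> Z. Lag (fst t) (snd t) y) + B"
  proof (rule cSUP_least)
    fix v assume v: "v \<in> Y"
    have "Lag x z v - B \<le> (INF t\<in>X \<times> Z. Lag (fst t) (snd t) y)"
    proof (rule cINF_greatest)
      fix t assume "t \<in> X \<times> Z"
      then show "Lag x z v - B \<le> Lag (fst t) (snd t) y"
        using assms[of "fst t" "snd t" v] v by auto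
    qed (use nonempty_sets in auto)
    then show "Lag x z v \<le> (INF t\<in>X \<times> Z. Lag (fst t) (snd t) y) + B" by simp
  qed (rule nonempty_sets)
  then show ?thesis by (simp add: gap_def case_prod_beta')
qed

text \<open>Serves to make the random gap measurable, which a supremum over an uncountable set does
  not give by itself.\<close>

lemma continuous_on_Gap: "continuous_on UNIV Gap"
proof -
  define S where "S = X \<times> Z \<times> Y"
  \<comment> \<open>Up to a continuous summand, the gap is a supremum of affine functions of \<open>(x, z, y)\<close>.\<close>
  define c :: "('d, 's) point \<Rightarrow> real" where "c = (\<lambda>(u, w, v). - objective u w)"
  define J where "J = (\<lambda>(u, w, v). (transpose A *v v, - v, w - A *v u))"
  have S: "compact S" "S \<noteq> {}"
    using compact_sets nonempty_sets by (auto simp: S_def intro: compact_Times)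
  have Lag_diff: "Lag x z v - Lag u w y = objective x z + (c (u, w, v) + (x, z, y) \<bullet> J (u, w, v))"
    for x z y u w v
    using inner_transpose_matrix_vector[of A v x]
    by (simp add: lagrangian_eq c_def J_def inner_prod_def inner_diff inner_commute)
  have contJ: "continuous_on S J"
    unfolding J_def case_prod_beta'
    by (intro continuous_intros bounded_linear.continuous_on[OF matrix_vector_mul_bounded_linear])
  then have bJ: "bounded (J ` S)"
    by (intro compact_imp_bounded compact_continuous_image S)
  have "continuous_on S c"
    unfolding c_def case_prod_beta' by (intro continuous_intros)
  then have bc: "bdd_above (c ` S)"
    by (intro bounded_imp_bdd_above compact_imp_bounded compact_continuous_image S)
  have bdd: "bdd_above ((\<lambda>u. c u + p \<bullet> J u) ` S)" for p
    by (intro bounded_imp_bdd_above compact_imp_bounded compact_continuous_image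
        continuous_intros S contJ \<open>continuous_on S c\<close>)
  have "Gap p = objective (fst p) (fst (snd p)) + (SUP u\<in>S. c u + p \<bullet> J u)" for p
  proof (rule antisym)
    obtain x z y where p: "p = (x, z, y)" by (cases p)
    show "Gap p \<le> objective (fst p) (fst (snd p)) + (SUP u\<in>S. c u + p \<bullet> J u)"
      unfolding p
    proof (rule Gap_le)
      fix u w v assume "u \<in> X" "w \<in> Z" "v \<in> Y"
      then have "(u, w, v) \<in> S" by (simp add: S_def)
      from cSUP_upper[OF this bdd[of p]]
      show "Lag x z v - Lag u w y \<le> objective (fst (x, z, y)) (fst (snd (x, z, y))) +
          (SUP u\<in>S. c u + (x, z, y) \<bullet> J u)"
        unfolding Lag_diff p by simp
    qed
    have "(SUP u\<in>S. c u + p \<bullet> J u) \<le> Gap p - objective x z"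
    proof (rule cSUP_least[OF S(2)])
      fix t assume "t \<in> S"
      then obtain u w v where t: "t = (u, w, v)" "u \<in> X" "w \<in> Z" "v \<in> Y"
        by (auto simp: S_def)
      from Lag_diff_le_Gap[OF t(2-4), of x z y]
      show "c t + p \<bullet> J t \<le> Gap p - objective x z"
        unfolding Lag_diff t(1) p by simp
    qed
    then show "objective (fst p) (fst (snd p)) + (SUP u\<in>S. c u + p \<bullet> J u) \<le> Gap p"
      by (simp add: p)
  qed
  moreover have "continuous_on UNIV
      (\<lambda>p. objective (fst p) (fst (snd p)) + (SUP u\<in>S. c u + p \<bullet> J u))"
    by (intro continuous_on_add[OF continuous_on_objective] continuous_on_SUP_affine S(2) bc bJ
        continuous_intros)
  ultimately show ?thesis by simp
qed

text \<open>For fixed \<open>(u, w, v)\<close> the difference is jointly convex in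
  \<open>(x, z, y)\<close>, affine in \<open>y\<close>. This supplies the subgradient for
  \<open>mean_le_of_subgradient\<close>.\<close>

lemma Lag_diff_subgradient:
  "Lag x z v - Lag u w y + (separable_gradient blk r x + transpose A *v v,
      gradient_on UNIV (\<lambda>t. ell t b) z - v, w - A *v u) \<bullet> ((x', z', y') - (x, z, y))
    \<le> Lag x' z' v - Lag u w y'"
proof -
  have "ell z b + gradient_on UNIV (\<lambda>t. ell t b) z \<bullet> (z' - z) \<le> ell z' b"
    using ell_smooth ell_convex by (intro convex_on_gradient_on_le) (auto simp: L_smooth_on_def)
  moreover note separable_gradient_le[OF r_smooth r_convex, of x x']
  moreover have "(transpose A *v v) \<bullet> (x' - x) = v \<bullet> (A *v x') - v \<bullet> (A *v x)"
    unfolding inner_transpose_matrix_vector by (simp add: matrix_vector_mult_diff_distrib inner_diff)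
  ultimately show ?thesis
    by (simp add: lagrangian_eq inner_prod_def inner_add inner_diff inner_commute)
qed

text \<open>First-order convexity for \<open>ell\<close> and the \<open>r i\<close>, and the skew
  identity for the coupling.\<close>

lemma Lag_diff_le_operator:
  "Lag x z v - Lag u w y \<le> F (x, z, y) \<bullet> ((x, z, y) - (u, w, v))"
proof -
  have "ell z b + gradient_on UNIV (\<lambda>t. ell t b) z \<bullet> (w - z) \<le> ell w b"
    using ell_smooth ell_convex by (intro convex_on_gradient_on_le) (auto simp: L_smooth_on_def)
  moreover note separable_gradient_le[OF r_smooth r_convex, of x u]
  moreover note inner_skew_coupling[of v A x z y u w]
  ultimately show ?thesis
    by (simp add: lagrangian_eq lagrangian_operator_def saddle_operator_def inner_prod_def
        inner_add inner_diff)
qed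

lemma F_contraction:
  assumes "0 \<le> \<gamma>" "\<gamma> \<le> 1 / 2" "\<gamma> * Lr \<le> 1 / 2" "\<gamma> * Ll \<le> 1 / 2"
      "8 * (\<gamma>\<^sup>2 * lambda_max (transpose A ** A)) \<le> 1"
  shows "\<gamma>\<^sup>2 * (norm (F p - F q))\<^sup>2 \<le> 7 / 8 * (norm (p - q))\<^sup>2"
  unfolding lagrangian_operator_def
  by (rule saddle_operator_contraction[OF separable_gradient_lipschitz[OF r_smooth] _ assms])
    (use ell_smooth in \<open>simp add: L_smooth_on_def\<close>)

lemma norm_sq_le_diam_sq:
  assumes "u \<in> X" "w \<in> Z" "v \<in> Y"
  shows "(norm (p0 - (u, w, v)))\<^sup>2 \<le> diam_sq X Z Y p0"
proof -
  obtain x0 z0 y0 where p0: "p0 = (x0, z0, y0)" by (cases p0)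
  let ?f = "\<lambda>t. (norm (x0 - fst t))\<^sup>2 + (norm (z0 - fst (snd t)))\<^sup>2 + (norm (y0 - snd (snd t)))\<^sup>2"
  have "compact (?f ` (X \<times> Z \<times> Y))"
    by (intro compact_continuous_image continuous_intros compact_Times compact_sets)
  then have "?f (u, w, v) \<le> (SUP t\<in>X \<times> Z \<times> Y. ?f t)"
    using assms by (intro cSUP_upper bounded_imp_bdd_above compact_imp_bounded) auto
  then show ?thesis
    by (simp add: p0 diam_sq_def case_prod_beta' norm_prod_def)
qed

text \<open>For each \<open>(u, w, v)\<close>, Jensen passes to the half iterates, convexity to the
  operator, and the regret bound applies. As \<open>?R\<close> does not involve
  \<open>(u, w, v)\<close>, the result passes to the gap.\<close>

lemma gap_average_iterate_le:
  fixes e :: "nat \<Rightarrow> stage \<Rightarrow> 'n noise_role \<Rightarrow> real^'s"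
  assumes contr: "\<And>p q. \<gamma>\<^sup>2 * (norm (F p - F q))\<^sup>2 \<le> 7 / 8 * (norm (p - q))\<^sup>2"
    and \<gamma>: "0 < \<gamma>" and K: "0 < K"
  defines "N \<equiv> \<lambda>k h. transmission_noise A (e k h)"
  shows "real K * Gap (average_iterate blk A b ell r \<gamma> p0 e K) \<le>
    3 / (4 * \<gamma>) * diam_sq X Z Y p0 +
    (8 * \<gamma> * (\<Sum>k<K. (norm (N k Half))\<^sup>2 + (norm (N k Full))\<^sup>2) +
     \<gamma> * (norm (\<Sum>k<K. N k Half))\<^sup>2 -
     (\<Sum>k<K. N k Half \<bullet> (extragradient_half F \<gamma> p0 N k - p0)))" (is "_ \<le> ?D + ?R")
proof -
  define q where "q = extragradient_half F \<gamma> p0 N"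
  define a where "a = (1 / real K) *\<^sub>R (\<Sum>k<K. q k)"
  have avg: "average_iterate blk A b ell r \<gamma> p0 e K = a"
    by (simp add: average_iterate_def half_iterate_eq_extragradient_half a_def q_def N_def)
  obtain x z y where a': "a = (x, z, y)" by (cases a)
  have "Gap (x, z, y) \<le> (?D + ?R) / real K"
  proof (rule Gap_le)
    fix u w v assume uwv: "u \<in> X" "w \<in> Z" "v \<in> Y"
    let ?f = "\<lambda>(x, z, y). Lag x z v - Lag u w y"
    have "real K * ?f a \<le> (\<Sum>k<K. ?f (q k))"
    proof (rule mean_le_of_subgradient[OF K a_def])
      fix t
      show "?f a + (separable_gradient blk r x + transpose A *v v,
          gradient_on UNIV (\<lambda>t. ell t b) z - v, w - A *v u) \<bullet> (t - a) \<le> ?f t"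
        using Lag_diff_subgradient[of x z v u w y "fst t" "fst (snd t)" "snd (snd t)"]
        by (simp add: a' case_prod_beta')
    qed
    also have "\<dots> \<le> (\<Sum>k<K. F (q k) \<bullet> (q k - (u, w, v)))"
    proof (rule sum_mono)
      fix k
      obtain x' z' y' where "q k = (x', z', y')" by (cases "q k")
      then show "?f (q k) \<le> F (q k) \<bullet> (q k - (u, w, v))"
        using Lag_diff_le_operator[of x' z' v u w y'] by simp
    qed
    also have "\<dots> \<le> 3 / (4 * \<gamma>) * (norm (p0 - (u, w, v)))\<^sup>2 + ?R"
      unfolding q_def by (rule extragradient_regret[OF contr \<gamma>])
    also have "\<dots> \<le> ?D + ?R"
      using norm_sq_le_diam_sq[OF uwv, of p0] \<gamma> by (intro add_right_mono mult_left_mono) auto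
    finally show "Lag x z v - Lag u w y \<le> (?D + ?R) / real K"
      using K by (simp add: a' le_divide_eq mult.commute)
  qed
  then show ?thesis using K unfolding avg a' by (simp add: le_divide_eq mult.commute)
qed

end

section \<open>Noise moments and the rate\<close>

lemma transmission_noise_measurable:
  fixes e :: "'n::finite noise_role \<Rightarrow> 'w \<Rightarrow> real^'s" and A :: "real^'d^'s"
  assumes [measurable]: "\<And>j. e j \<in> borel_measurable M"
  shows "(\<lambda>\<omega>. transmission_noise A (\<lambda>j. e j \<omega>)) \<in> borel_measurable M"
proof -
  have [measurable]: "(*v) (transpose A) \<in> borel_measurable borel"
    by (intro borel_measurable_continuous_onI linear_continuous_on matrix_vector_mul_bounded_linear)
  show ?thesis unfolding transmission_noise_def by measurable
qed

text \<open>The Gram bound is applied to \<open>transpose A\<close>, whose Gram matrix is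
  \<open>A ** transpose A\<close>.\<close>

lemma norm_transmission_noise_sq_le:
  "(norm (transmission_noise A e))\<^sup>2 \<le>
    lambda_max (A ** transpose A) * (norm (e Dual))\<^sup>2 + (norm (\<Sum>i\<in>UNIV. e (Device i)))\<^sup>2"
  using norm_matrix_vector_le_lambda_max[of "transpose A" "e Dual"]
  by (simp add: transmission_noise_def norm_prod_def)

lemma transmission_noise_eq_sum:
  "transmission_noise A e = (transpose A *v e Dual, 0, 0) + (\<Sum>i\<in>UNIV. (0, 0, - e (Device i)))"
  by (simp add: transmission_noise_def prod_eq_iff fst_sum snd_sum sum_negf)

context prob_space
begin

context
  fixes \<xi> :: "nat \<Rightarrow> stage \<Rightarrow> 'n::finite noise_role \<Rightarrow> 'a \<Rightarrow> real^'s" and A :: "real^'d^'s"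
    and K :: nat and \<sigma> :: real
  assumes ind: "indep_vars (\<lambda>_. borel) (\<lambda>(k, h, j). \<xi> k h j) ({..<K} \<times> UNIV \<times> UNIV)"
    and zero: "\<And>k h j. k < K \<Longrightarrow> expectation (\<xi> k h j) = 0"
    and int: "\<And>k h j. k < K \<Longrightarrow> integrable M (\<lambda>\<omega>. (norm (\<xi> k h j \<omega>))\<^sup>2)"
    and var: "\<And>k h j. k < K \<Longrightarrow> expectation (\<lambda>\<omega>. (norm (\<xi> k h j \<omega>))\<^sup>2) \<le> \<sigma>\<^sup>2"
begin

lemma noise_square_integrable:
  assumes "k < K"
  shows "square_integrable M (\<xi> k h j)"
proof -
  have "(k, h, j) \<in> {..<K} \<times> UNIV \<times> UNIV" using assms by simp
  then have "(case (k, h, j) of (k, h, j) \<Rightarrow> \<xi> k h j) \<in> borel_measurable M"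
    using ind[unfolded indep_vars_def2] by (rule bspec[OF conjunct1, rotated])
  then show ?thesis using int[OF assms] by (simp add: square_integrable_def)
qed

text \<open>Independence across devices makes the device contributions add up to
  \<open>n \<sigma>\<^sup>2\<close> instead of \<open>n\<^sup>2 \<sigma>\<^sup>2\<close>. The mean
  is computed through the decomposition into bounded linear images of single noises.\<close>

lemma transmission_noise_moments:
  assumes k: "k < K"
  shows "square_integrable M (\<lambda>\<omega>. transmission_noise A (\<lambda>j. \<xi> k h j \<omega>))"
    and "expectation (\<lambda>\<omega>. transmission_noise A (\<lambda>j. \<xi> k h j \<omega>)) = 0"
    and "expectation (\<lambda>\<omega>. (norm (transmission_noise A (\<lambda>j. \<xi> k h j \<omega>)))\<^sup>2) \<le>
      (lambda_max (A ** transpose A) + real CARD('n)) * \<sigma>\<^sup>2"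
proof -
  let ?N = "\<lambda>\<omega>. transmission_noise A (\<lambda>j. \<xi> k h j \<omega>)"
  let ?l = "lambda_max (A ** transpose A)"
  let ?S = "\<lambda>\<omega>. (norm (\<Sum>i\<in>UNIV. \<xi> k h (Device i) \<omega>))\<^sup>2"
  let ?g = "\<lambda>\<omega>. ?l * (norm (\<xi> k h Dual \<omega>))\<^sup>2 + ?S \<omega>"
  have l: "0 \<le> ?l" using lambda_max_gram_nonneg[of "transpose A"] by simp
  have S: "integrable M ?S"
    using square_integrable_sum[of UNIV "\<lambda>i. \<xi> k h (Device i)"] noise_square_integrable[OF k]
    by (simp add: square_integrable_def)
  have g: "integrable M ?g" using S int[OF k] by simp
  have "\<xi> k h j \<in> borel_measurable M" for j
    using noise_square_integrable[OF k] by (simp add: square_integrable_def)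
  then show N: "square_integrable M ?N"
    using g norm_transmission_noise_sq_le
    by (intro square_integrable_bound[where g = ?g] transmission_noise_measurable)
  have \<xi>: "integrable M (\<xi> k h j)" for j
    by (rule square_integrable_integrable[OF noise_square_integrable[OF k]])
  have J1: "bounded_linear (\<lambda>v. (transpose A *v v, 0::real^'s, 0::real^'s))"
    by (intro bounded_linear_Pair matrix_vector_mul_bounded_linear bounded_linear_zero)
  have J2: "bounded_linear (\<lambda>v. (0::real^'d, 0::real^'s, - v :: real^'s))"
    by (intro bounded_linear_Pair bounded_linear_minus bounded_linear_ident bounded_linear_zero)
  show "expectation ?N = 0"
    unfolding transmission_noise_eq_sum
    using integrable_bounded_linear[OF J1 \<xi>] integrable_bounded_linear[OF J2 \<xi>]
      integral_bounded_linear[OF J1 \<xi>] integral_bounded_linear[OF J2 \<xi>] zero[OF k]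
    by (simp add: Bochner_Integration.integral_sum zero_prod_def[symmetric])
  have "indep_vars (\<lambda>_. borel) (\<lambda>(k, h, j). \<xi> k h j) ((\<lambda>i. (k, h, Device i)) ` UNIV)"
    by (rule indep_vars_subset[OF ind]) (use k in auto)
  from expectation_norm_sum_indep[OF this] noise_square_integrable[OF k] zero[OF k]
  have "expectation ?S = (\<Sum>i\<in>UNIV. expectation (\<lambda>\<omega>. (norm (\<xi> k h (Device i) \<omega>))\<^sup>2))"
    by (auto simp: sum.reindex inj_on_def)
  also have "\<dots> \<le> real CARD('n) * \<sigma>\<^sup>2"
    using sum_bounded_above[of UNIV "\<lambda>i. expectation (\<lambda>\<omega>. (norm (\<xi> k h (Device i) \<omega>))\<^sup>2)" "\<sigma>\<^sup>2"] var[OF k]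
    by simp
  finally have eS: "expectation ?S \<le> real CARD('n) * \<sigma>\<^sup>2" .
  have "expectation (\<lambda>\<omega>. (norm (?N \<omega>))\<^sup>2) \<le> expectation ?g"
    using N g norm_transmission_noise_sq_le
    by (intro integral_mono) (auto simp: square_integrable_def)
  also have "\<dots> = ?l * expectation (\<lambda>\<omega>. (norm (\<xi> k h Dual \<omega>))\<^sup>2) + expectation ?S"
    using S int[OF k] by simp
  also have "\<dots> \<le> ?l * \<sigma>\<^sup>2 + real CARD('n) * \<sigma>\<^sup>2"
    by (intro add_mono mult_left_mono var k l eS)
  finally show "expectation (\<lambda>\<omega>. (norm (?N \<omega>))\<^sup>2) \<le> (?l + real CARD('n)) * \<sigma>\<^sup>2"
    by (simp add: distrib_right)
qed

text \<open>Noises are grouped by \<open>(k, h)\<close>; functions of disjoint groups of an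
  independent family are independent.\<close>

lemma transmission_noise_indep:
  "indep_vars (\<lambda>_. borel) (\<lambda>(k, h) \<omega>. transmission_noise A (\<lambda>j. \<xi> k h j \<omega>)) ({..<K} \<times> UNIV)"
proof -
  let ?B = "\<lambda>(k, h). {k} \<times> {h} \<times> UNIV :: (nat \<times> stage \<times> 'n noise_role) set"
  let ?X = "\<lambda>l \<omega>. restrict (\<lambda>i. (case i of (k, h, j) \<Rightarrow> \<xi> k h j) \<omega>) (?B l)"
  let ?Y = "\<lambda>l e. transmission_noise A (\<lambda>j. e (fst l, snd l, j))"
  have B: "indep_vars (\<lambda>l. PiM (?B l) (\<lambda>_. borel)) ?X ({..<K} \<times> UNIV)"
    by (rule indep_vars_restrict[OF ind]) (auto simp: disjoint_family_on_def)
  have "?Y l \<in> borel_measurable (PiM (?B l) (\<lambda>_. borel))" for l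
    by (cases l) (auto intro!: transmission_noise_measurable measurable_component_singleton)
  from indep_vars_compose2[OF B this]
  have "indep_vars (\<lambda>_. borel) (\<lambda>l \<omega>. ?Y l (?X l \<omega>)) ({..<K} \<times> UNIV)" .
  then show ?thesis by (simp add: case_prod_beta')
qed

end

end

section \<open>Stepsize, rate and expected gap\<close>

text \<open>The minimum is attained, so \<open>1 / \<gamma>\<close> is one of the reciprocals and
  hence at most their sum. Only the noise entry can be zero, and only when
  \<open>D2 = 0\<close>.\<close>

lemma stepsize_bounds:
  fixes A :: "real^'d^'s" and \<sigma> :: real
  assumes L: "0 < Lr" "0 < Ll" and D2: "0 \<le> D2" and n: "0 < n" and K: "0 < K"
  defines "\<gamma> \<equiv> stepsize A n Lr Ll \<sigma> D2 K"
    and "l \<equiv> lambda_max (transpose A ** A)"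
    and "v \<equiv> (lambda_max (A ** transpose A) + real n) * \<sigma>\<^sup>2"
  shows "0 \<le> \<gamma>" "\<gamma> \<le> 1 / 2" "\<gamma> * Lr \<le> 1 / 2" "\<gamma> * Ll \<le> 1 / 2" "8 * (\<gamma>\<^sup>2 * l) \<le> 1"
    and "\<sigma> \<noteq> 0 \<Longrightarrow> \<gamma> \<le> sqrt (D2 / (8 * v * real K))"
    and "\<gamma> = 0 \<Longrightarrow> D2 = 0"
    and "1 / \<gamma> \<le> 2 + 2 * Lr + 2 * Ll + sqrt (8 * l) +
      (if \<sigma> = 0 then 0 else 1 / sqrt (D2 / (8 * v * real K)))"
proof -
  define T where "T = {1 / 2, 1 / (2 * Lr), 1 / (2 * Ll)} \<union>
    (if l = 0 then {} else {1 / sqrt (8 * l)}) \<union>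
    (if \<sigma> = 0 then {} else {sqrt (D2 / (8 * v * real K))})"
  have v8: "8 * v * real K = 8 * (lambda_max (A ** transpose A) + real n) * \<sigma>\<^sup>2 * real K"
    by (simp add: v_def)
  have \<gamma>: "\<gamma> = Min T"
    unfolding \<gamma>_def stepsize_def T_def l_def v8 ..
  have T: "finite T" "T \<noteq> {}" by (auto simp: T_def)
  have l: "0 \<le> l" unfolding l_def by (rule lambda_max_gram_nonneg)
  have ln: "0 < lambda_max (A ** transpose A) + real n"
    using lambda_max_gram_nonneg[of "transpose A"] n by simp
  have v: "0 < v" if "\<sigma> \<noteq> 0" using that ln by (simp add: v_def)
  have v0: "0 \<le> v" using ln by (simp add: v_def)
  have le: "\<gamma> \<le> t" if "t \<in> T" for t unfolding \<gamma> using T that by simp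
  have mem: "\<gamma> \<in> T" unfolding \<gamma> using T by (rule Min_in)
  have T0: "0 \<le> t" if "t \<in> T" for t
    using that L D2 l v0 by (auto simp: T_def split: if_splits)
  show \<gamma>0: "0 \<le> \<gamma>" by (rule T0[OF mem])
  show "\<gamma> \<le> 1 / 2" by (rule le) (simp add: T_def)
  have "\<gamma> \<le> 1 / (2 * Lr)" by (rule le) (simp add: T_def)
  then show "\<gamma> * Lr \<le> 1 / 2" using L by (simp add: field_simps)
  have "\<gamma> \<le> 1 / (2 * Ll)" by (rule le) (simp add: T_def)
  then show "\<gamma> * Ll \<le> 1 / 2" using L by (simp add: field_simps)
  show "8 * (\<gamma>\<^sup>2 * l) \<le> 1"
  proof (cases "l = 0")
    case False
    then have "\<gamma> \<le> 1 / sqrt (8 * l)" by (intro le) (simp add: T_def)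
    then have "\<gamma>\<^sup>2 \<le> (1 / sqrt (8 * l))\<^sup>2" using \<gamma>0 by (rule power_mono)
    also have "\<dots> = 1 / (8 * l)" using l by (simp add: power_divide)
    finally show ?thesis using l False by (simp add: field_simps)
  qed simp
  show "\<gamma> \<le> sqrt (D2 / (8 * v * real K))" if "\<sigma> \<noteq> 0"
    using that by (intro le) (simp add: T_def)
  show "D2 = 0" if "\<gamma> = 0"
    using mem L l v K unfolding that T_def by (auto split: if_splits)
  have s: "0 \<le> (if \<sigma> = 0 then 0 else 1 / sqrt (D2 / (8 * v * real K)))" (is "0 \<le> ?s")
    using D2 v0 by simp
  consider "\<gamma> = 1 / 2" | "\<gamma> = 1 / (2 * Lr)" | "\<gamma> = 1 / (2 * Ll)" | "\<gamma> = 1 / sqrt (8 * l)"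
    | "\<sigma> \<noteq> 0" "\<gamma> = sqrt (D2 / (8 * v * real K))"
    using mem by (auto simp: T_def split: if_splits)
  then show "1 / \<gamma> \<le> 2 + 2 * Lr + 2 * Ll + sqrt (8 * l) + ?s"
  proof cases
    case 5
    then show ?thesis using L l by simp
  qed (use L l s in \<open>simp_all only: divide_divide_eq_right mult_1_left div_by_1\<close>, auto)
qed

text \<open>The noise entry \<open>s\<close> of the stepsize balances the two errors:
  \<open>D2 / (K s) = 8 v s\<close>, a multiple of \<open>T\<close>. The distance term uses the
  bound on \<open>1 / \<gamma>\<close>, the noise term uses \<open>\<gamma> \<le> s\<close>.\<close>

lemma rate_bound:
  fixes D2 v K \<gamma> c :: real
  assumes "0 < \<gamma>" "0 \<le> D2" "0 \<le> v" "0 < K" "0 \<le> c"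
    and inv: "1 / \<gamma> \<le> c + (if v = 0 then 0 else 1 / sqrt (D2 / (8 * v * K)))"
    and le: "v \<noteq> 0 \<Longrightarrow> \<gamma> \<le> sqrt (D2 / (8 * v * K))"
  shows "(3 / (4 * \<gamma>) * D2 + 17 * \<gamma> * K * v) / K \<le> 3 / 4 * c * D2 / K + 9 * sqrt (v * D2 / K)"
proof (cases "v = 0")
  case True
  have "3 / (4 * \<gamma>) * D2 = 3 / 4 * D2 * (1 / \<gamma>)" by simp
  also have "\<dots> \<le> 3 / 4 * D2 * c" using inv True \<open>0 \<le> D2\<close> by (intro mult_left_mono) auto
  finally have "3 / (4 * \<gamma>) * D2 / K \<le> 3 / 4 * D2 * c / K"
    using \<open>0 < K\<close> by (simp only: divide_right_mono less_imp_le)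
  then show ?thesis using True by (simp add: mult_ac)
next
  case False
  define s where "s = sqrt (D2 / (8 * v * K))"
  define T where "T = sqrt (v * D2 / K)"
  have v: "0 < v" using False \<open>0 \<le> v\<close> by simp
  have s: "0 < s" unfolding s_def by (rule less_le_trans[OF \<open>0 < \<gamma>\<close> le[OF False]])
  have s2: "s\<^sup>2 = D2 / (8 * v * K)" using assms by (simp add: s_def)
  then have D2: "D2 = s\<^sup>2 * (8 * v * K)" using v \<open>0 < K\<close> by simp
  have T0: "0 \<le> T" using assms by (simp add: T_def)
  have T2: "T\<^sup>2 = v * D2 / K" using assms by (simp add: T_def)
  \<comment> \<open>In fact \<open>v s = T / sqrt 8\<close>; the rational 3/8 is slightly larger
    than \<open>1 / sqrt 8\<close>.\<close>
  have vs: "v * s \<le> 3 / 8 * T"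
  proof (rule power2_le_imp_le)
    have "(v * s)\<^sup>2 = T\<^sup>2 / 8" unfolding T2 power_mult_distrib s2
      using v \<open>0 < K\<close> by (simp add: field_simps power2_eq_square)
    moreover have "(3 / 8 * T)\<^sup>2 = 9 / 64 * T\<^sup>2" by (simp add: power2_eq_square)
    ultimately show "(v * s)\<^sup>2 \<le> (3 / 8 * T)\<^sup>2" using zero_le_power2[of T] by linarith
  qed (use T0 in simp)
  have Ds: "D2 / K * (1 / s) = 8 * (v * s)"
    unfolding D2 using s \<open>0 < K\<close> by (simp add: power2_eq_square)
  have "(3 / (4 * \<gamma>) * D2 + 17 * \<gamma> * K * v) / K = 3 / 4 * (D2 / K) * (1 / \<gamma>) + 17 * (\<gamma> * v)"
    using assms by (simp add: field_simps)
  also have "\<dots> \<le> 3 / 4 * (D2 / K) * (c + 1 / s) + 17 * (s * v)"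
    using inv le[OF False] False assms(2-4) unfolding s_def
    by (intro add_mono mult_left_mono mult_right_mono) auto
  \<comment> \<open>\<open>23 = 3/4 * 8 + 17\<close>, and \<open>23 * 3/8 = 69/8\<close> is below
    9.\<close>
  also have "\<dots> = 3 / 4 * c * D2 / K + 23 * (v * s)"
    unfolding distrib_left mult.assoc Ds by simp
  also have "\<dots> \<le> 3 / 4 * c * D2 / K + 9 * T" using vs T0 by simp
  finally show ?thesis by (simp add: T_def)
qed

context saddle_problem
begin

lemma diam_sq_nonneg: "0 \<le> diam_sq X Z Y p0"
proof -
  obtain u w v where "u \<in> X" "w \<in> Z" "v \<in> Y" using nonempty_sets by blast
  from norm_sq_le_diam_sq[OF this, of p0] show ?thesis by (rule order_trans[OF zero_le_power2])
qed

text \<open>If the largest distance from \<open>p0\<close> is zero, each of the sets is the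
  corresponding component of \<open>p0\<close>, so every Lagrangian difference vanishes.\<close>

lemma Gap_average_iterate_zero_stepsize:
  assumes "diam_sq X Z Y p0 = 0" "0 < K"
  shows "average_iterate blk A b ell r 0 p0 e K = p0" and "Gap p0 \<le> 0"
proof -
  have "half_iterate blk A b ell r 0 p0 e k = p0" for k
    unfolding half_iterate_eq_extragradient_half extragradient_half_def
    by (induction k) (simp_all add: Let_def)
  then show "average_iterate blk A b ell r 0 p0 e K = p0"
    using \<open>0 < K\<close> by (simp add: average_iterate_def sum_constant_scaleR)
  have p0: "p0 = (u, w, v)" if "u \<in> X" "w \<in> Z" "v \<in> Y" for u w v
    using norm_sq_le_diam_sq[OF that, of p0] assms(1) by simp
  obtain x z y where [simp]: "p0 = (x, z, y)" by (cases p0)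
  have "Gap (x, z, y) \<le> 0"
  proof (rule Gap_le)
    fix u w v assume "u \<in> X" "w \<in> Z" "v \<in> Y"
    from p0[OF this] show "Lag x z v - Lag u w y \<le> 0" by simp
  qed
  then show "Gap p0 \<le> 0" by simp
qed

text \<open>The pathwise bound \<open>U\<close> controls the gap from above. The average may leave
  the sets and the gap may be negative, so integrability also needs a lower bound, which is affine
  in the average.\<close>

lemma expected_gap_bound:
  fixes M :: "'w measure" and \<xi> :: "nat \<Rightarrow> stage \<Rightarrow> 'n noise_role \<Rightarrow> 'w \<Rightarrow> real^'s"
    and p0 :: "('d, 's) point" and \<sigma> :: real
  assumes contr: "\<And>p q. \<gamma>\<^sup>2 * (norm (F p - F q))\<^sup>2 \<le> 7 / 8 * (norm (p - q))\<^sup>2"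
    and \<gamma>: "0 < \<gamma>" and K: "0 < K" and "prob_space M"
    and ind: "prob_space.indep_vars M (\<lambda>_. borel) (\<lambda>(k, h, j). \<xi> k h j) ({..<K} \<times> UNIV \<times> UNIV)"
    and zero: "\<And>k h j. k < K \<Longrightarrow> prob_space.expectation M (\<xi> k h j) = 0"
    and int: "\<And>k h j. k < K \<Longrightarrow> integrable M (\<lambda>\<omega>. (norm (\<xi> k h j \<omega>))\<^sup>2)"
    and var: "\<And>k h j. k < K \<Longrightarrow> prob_space.expectation M (\<lambda>\<omega>. (norm (\<xi> k h j \<omega>))\<^sup>2) \<le> \<sigma>\<^sup>2"
  defines "G \<equiv> \<lambda>\<omega>. Gap (average_iterate blk A b ell r \<gamma> p0 (\<lambda>k h j. \<xi> k h j \<omega>) K)"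
    and "v \<equiv> (lambda_max (A ** transpose A) + real CARD('n)) * \<sigma>\<^sup>2"
  shows "integrable M G"
    and "prob_space.expectation M G \<le>
      (3 / (4 * \<gamma>) * diam_sq X Z Y p0 + 17 * \<gamma> * real K * v) / real K"
proof -
  interpret prob_space M by fact
  define N where "N k h \<omega> = transmission_noise A (\<lambda>j. \<xi> k h j \<omega>)" for k h \<omega>
  define R where "R \<omega> = 8 * \<gamma> * (\<Sum>k<K. (norm (N k Half \<omega>))\<^sup>2 + (norm (N k Full \<omega>))\<^sup>2) +
     \<gamma> * (norm (\<Sum>k<K. N k Half \<omega>))\<^sup>2 -
     (\<Sum>k<K. N k Half \<omega> \<bullet> (extragradient_half F \<gamma> p0 (\<lambda>j h. N j h \<omega>) k - p0))" for \<omega>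
  define a where "a \<omega> = average_iterate blk A b ell r \<gamma> p0 (\<lambda>k h j. \<xi> k h j \<omega>) K" for \<omega>
  define U where "U \<omega> = (3 / (4 * \<gamma>) * diam_sq X Z Y p0 + R \<omega>) / real K" for \<omega>
  have F: "(1 / \<gamma>)-lipschitz_on UNIV F"
    by (rule lipschitz_on_of_contraction[OF \<gamma> contr])
  have N: "square_integrable M (N k h)" "expectation (N k h) = 0"
    "expectation (\<lambda>\<omega>. (norm (N k h \<omega>))\<^sup>2) \<le> v" if "k < K" for k h
    unfolding N_def v_def using transmission_noise_moments[OF ind zero int var that, of A h] by simp_all
  have indN: "indep_vars (\<lambda>_. borel) (\<lambda>(k, h). N k h) ({..<K} \<times> UNIV)"
    unfolding N_def using transmission_noise_indep[OF ind zero int var, of A] by simp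
  have R: "integrable M R" "expectation R \<le> 17 * \<gamma> * real K * v"
    unfolding R_def using extragradient_expected_noise[OF F less_imp_le[OF \<gamma>] indN N, of p0] by simp_all
  have U: "integrable M U" unfolding U_def using R by simp
  have upper: "G \<omega> \<le> U \<omega>" for \<omega>
    using gap_average_iterate_le[OF contr \<gamma> K, of p0 "\<lambda>k h j. \<xi> k h j \<omega>"] K
    by (simp add: G_def U_def R_def N_def le_divide_eq mult.commute)
  have "square_integrable M
      (\<lambda>\<omega>. (1 / real K) *\<^sub>R (\<Sum>k<K. extragradient_half F \<gamma> p0 (\<lambda>j h. N j h \<omega>) k))"
    by (intro square_integrable_scaleR square_integrable_sum
        extragradient_half_square_integrable[OF F] N) auto
  then have a: "square_integrable M a"
    unfolding a_def average_iterate_def half_iterate_eq_extragradient_half N_def .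
  obtain u1 u2 u3 where "u1 \<in> X" "u2 \<in> Z" "u3 \<in> Y" using nonempty_sets by blast
  then obtain u where u: "fst u \<in> X" "fst (snd u) \<in> Z" "snd (snd u) \<in> Y"
    using that[of "(u1, u2, u3)"] by simp
  \<comment> \<open>\<open>Lag_diff_le_operator\<close> with the roles exchanged: the operator is
    evaluated at the fixed point \<open>u\<close> of the sets, so the bound is affine in
    \<open>a \<omega>\<close>.\<close>
  have lower: "F u \<bullet> (a \<omega> - u) \<le> G \<omega>" for \<omega>
  proof -
    obtain x z y where x: "a \<omega> = (x, z, y)" by (cases "a \<omega>")
    have "F u \<bullet> (a \<omega> - u) = - (F u \<bullet> (u - a \<omega>))" by (simp add: inner_diff_right)
    also have "\<dots> \<le> Lag x z (snd (snd u)) - Lag (fst u) (fst (snd u)) y"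
      using Lag_diff_le_operator[of "fst u" "fst (snd u)" y x z "snd (snd u)"] by (simp add: x)
    also have "\<dots> \<le> G \<omega>"
      using Lag_diff_le_Gap[OF u, of x z y] by (simp add: G_def a_def[symmetric] x)
    finally show ?thesis .
  qed
  have low: "integrable M (\<lambda>\<omega>. F u \<bullet> (a \<omega> - u))"
    by (intro square_integrable_inner square_integrable_diff square_integrable_const a)
  have meas: "G \<in> borel_measurable M"
    unfolding G_def a_def[symmetric]
    by (rule measurable_compose[OF _ borel_measurable_continuous_onI[OF continuous_on_Gap]])
      (use a in \<open>simp add: square_integrable_def\<close>)
  show G: "integrable M G"
  proof (rule Bochner_Integration.integrable_bound)
    show "integrable M (\<lambda>\<omega>. \<bar>U \<omega>\<bar> + \<bar>F u \<bullet> (a \<omega> - u)\<bar>)" using U low by simp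
    show "AE \<omega> in M. norm (G \<omega>) \<le> norm (\<bar>U \<omega>\<bar> + \<bar>F u \<bullet> (a \<omega> - u)\<bar>)"
    proof (rule AE_I2)
      fix \<omega> show "norm (G \<omega>) \<le> norm (\<bar>U \<omega>\<bar> + \<bar>F u \<bullet> (a \<omega> - u)\<bar>)"
        using upper[of \<omega>] lower[of \<omega>] unfolding real_norm_def by linarith
    qed
  qed (rule meas)
  have "expectation G \<le> expectation U"
    using G U upper by (rule integral_mono)
  also have "\<dots> = (3 / (4 * \<gamma>) * diam_sq X Z Y p0 + expectation R) / real K"
    unfolding U_def using R(1) by (simp add: prob_space)
  also have "\<dots> \<le> (3 / (4 * \<gamma>) * diam_sq X Z Y p0 + 17 * \<gamma> * real K * v) / real K"
    using R(2) K by (simp add: divide_right_mono)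
  finally show "expectation G \<le>
      (3 / (4 * \<gamma>) * diam_sq X Z Y p0 + 17 * \<gamma> * real K * v) / real K" .
qed

end

text \<open>Integrability is part of the conclusion because the integral of a non-integrable
  function is 0 by convention, which would make the bound alone uninformative.\<close>

theorem theorem7:
  fixes M :: "'w measure"
    and blk :: "'d::finite \<Rightarrow> 'n::finite"
    and A :: "real^'d^'s"
    and b :: "real^'s"
    and ell :: "real^'s \<Rightarrow> real^'s \<Rightarrow> real"
    and r :: "'n \<Rightarrow> real^'d \<Rightarrow> real"
    and X :: "(real^'d) set" and Z Y :: "(real^'s) set"
    and x0 :: "real^'d" and z0 y0 :: "real^'s"
    and \<xi> :: "nat \<Rightarrow> stage \<Rightarrow> 'n noise_role \<Rightarrow> 'w \<Rightarrow> real^'s"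
    and Ll Lr \<sigma> D2 \<gamma> :: real
    and K :: nat
  assumes "surj blk"
    and "L_smooth_on UNIV Ll (\<lambda>z. ell z b)" and "convex_on UNIV (\<lambda>z. ell z b)"
    and "\<And>i. L_smooth_on (block_space blk i) Lr (r i)"
    and "\<And>i. convex_on (block_space blk i) (r i)"
    and "compact X" "X \<noteq> {}" and "compact Z" "Z \<noteq> {}" and "compact Y" "Y \<noteq> {}"
    and "prob_space M"
    and "prob_space.indep_vars M (\<lambda>_. borel) (\<lambda>(k, h, j). \<xi> k h j) ({..<K} \<times> UNIV \<times> UNIV)"
    and "\<And>k h j. k < K \<Longrightarrow> prob_space.expectation M (\<xi> k h j) = 0"
    and "\<And>k h j. k < K \<Longrightarrow> integrable M (\<lambda>\<omega>. (norm (\<xi> k h j \<omega>))\<^sup>2)"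
    and "\<And>k h j. k < K \<Longrightarrow> prob_space.expectation M (\<lambda>\<omega>. (norm (\<xi> k h j \<omega>))\<^sup>2) \<le> \<sigma>\<^sup>2"
    and "0 \<le> \<sigma>"
    and "0 < K"
    and "D2 = diam_sq X Z Y (x0, z0, y0)"
    and "\<gamma> = stepsize A CARD('n) Lr Ll \<sigma> D2 K"
  shows "integrable M (\<lambda>\<omega>. gap blk A b ell r X Z Y
           (average_iterate blk A b ell r \<gamma> (x0, z0, y0) (\<lambda>k h j. \<xi> k h j \<omega>) K)) \<and>
         prob_space.expectation M (\<lambda>\<omega>. gap blk A b ell r X Z Y
           (average_iterate blk A b ell r \<gamma> (x0, z0, y0) (\<lambda>k h j. \<xi> k h j \<omega>) K))
         \<le> rate_const *
             ((1 + sqrt (lambda_max (transpose A ** A)) + Lr + Ll) * D2 / real K +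
              sqrt ((lambda_max (A ** transpose A) + real CARD('n)) * \<sigma>\<^sup>2 * D2 / real K))"
proof -
  interpret prob_space M by fact
  interpret saddle_problem blk A b ell r X Z Y Ll Lr
    by unfold_locales fact+
  let ?l = "lambda_max (transpose A ** A)"
  let ?v = "(lambda_max (A ** transpose A) + real CARD('n)) * \<sigma>\<^sup>2"
  let ?G = "\<lambda>\<omega>. Gap (average_iterate blk A b ell r \<gamma> (x0, z0, y0) (\<lambda>k h j. \<xi> k h j \<omega>) K)"
  have L: "0 < Lr" "0 < Ll" using r_smooth ell_smooth by (auto simp: L_smooth_on_def)
  have D2: "0 \<le> D2" unfolding assms(19) by (rule diam_sq_nonneg)
  have l: "0 \<le> ?l" by (rule lambda_max_gram_nonneg)
  have ln: "0 < lambda_max (A ** transpose A) + real CARD('n)"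
    using lambda_max_gram_nonneg[of "transpose A"] by (simp add: add_nonneg_pos)
  then have v: "0 \<le> ?v" "?v = 0 \<longleftrightarrow> \<sigma> = 0" by auto
  note \<gamma> = stepsize_bounds[OF L D2 zero_less_card_finite[where 'a = 'n] \<open>0 < K\<close>, where A = A and \<sigma> = \<sigma>,
      folded assms(20)]
  \<comment> \<open>The stepsize vanishes when \<open>D = 0\<close> and \<open>\<sigma> > 0\<close>.\<close>
  show ?thesis
  proof (cases "\<gamma> = 0")
    case True
    then have "D2 = 0" by (rule \<gamma>(7))
    note * = Gap_average_iterate_zero_stepsize[OF this[unfolded assms(19)] \<open>0 < K\<close>]
    \<comment> \<open>The integrand is the constant \<open>Gap (x0, z0, y0)\<close>, and the claimed
      bound is 0 since \<open>D2 = 0\<close>.\<close>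
    show ?thesis using *(2) \<open>D2 = 0\<close> by (simp add: True *(1) prob_space)
  next
    case False
    then have "0 < \<gamma>" using \<gamma>(1) by simp
    have contr: "\<gamma>\<^sup>2 * (norm (F p - F q))\<^sup>2 \<le> 7 / 8 * (norm (p - q))\<^sup>2" for p q
      by (rule F_contraction[OF \<gamma>(1-5)])
    note bound = expected_gap_bound[OF contr \<open>0 < \<gamma>\<close> \<open>0 < K\<close> assms(12-16), of "(x0, z0, y0)",
        folded assms(19)]
    let ?c = "2 + 2 * Lr + 2 * Ll + sqrt (8 * ?l)"
    have "expectation ?G \<le> (3 / (4 * \<gamma>) * D2 + 17 * \<gamma> * real K * ?v) / real K"
      by (rule bound(2))
    also have "\<dots> \<le> 3 / 4 * ?c * D2 / real K + 9 * sqrt (?v * D2 / real K)"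
      using \<open>0 < \<gamma>\<close> D2 v \<open>0 < K\<close> L l \<gamma>(6,8) by (intro rate_bound) auto
    \<comment> \<open>The coefficients in \<open>?c\<close> are at most 3, so the first term needs
      only \<open>9/4\<close>; the 9 of the noise term is what calls for a constant near 10.\<close>
    also have "\<dots> \<le> 10 * ((1 + sqrt ?l + Lr + Ll) * D2 / real K) + 10 * sqrt (?v * D2 / real K)"
    proof (intro add_mono)
      have "sqrt 8 \<le> 3" by (rule real_le_lsqrt) auto
      then have "sqrt (8 * ?l) \<le> 3 * sqrt ?l"
        unfolding real_sqrt_mult using l by (intro mult_right_mono) auto
      then have "3 / 4 * ?c \<le> 10 * (1 + sqrt ?l + Lr + Ll)"
        unfolding distrib_left using L real_sqrt_ge_zero[OF l] by linarith
      then have "3 / 4 * ?c * (D2 / real K) \<le> 10 * (1 + sqrt ?l + Lr + Ll) * (D2 / real K)"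
        using D2 by (intro mult_right_mono) auto
      then show "3 / 4 * ?c * D2 / real K \<le> 10 * ((1 + sqrt ?l + Lr + Ll) * D2 / real K)"
        by (simp only: times_divide_eq_right mult.assoc)
      show "9 * sqrt (?v * D2 / real K) \<le> 10 * sqrt (?v * D2 / real K)"
        using v D2 by simp
    qed
    finally show ?thesis using bound(1) by (simp add: rate_const_def distrib_left)
  qed
qed

end
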